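(* Let $\mathcal{L}$ denote the equation $2x+2y=z$. Then $f_{\max}(n,\mathcal{L})=2^{n/4+o(n)}$.
   Context: $[n]=\{1,\dots,n\}$. A set $A\subseteq[n]$ is $\mathcal{L}$-free if there are no $x,y,z\in A$ (not necessarily distinct) with $2x+2y=z$. A set $S\subseteq[n]$ is a maximal $\mathcal{L}$-free subset of $[n]$ if it is $\mathcal{L}$-free and not properly contained in another $\mathcal{L}$-free subset of $[n]$; $f_{\max}(n,\mathcal{L})$ is the number of these. The $o(n)$ term is as $n\to\infty$. *)

theory Defs
  imports Complex_Main "HOL-Library.Landau_Symbols"
begin

definition L_free :: "nat set \<Rightarrow> bool" where
  "L_free A \<longleftrightarrow> \<not> (\<exists>x\<in>A. \<exists>y\<in>A. \<exists>z\<in>A. 2 * x + 2 * y = z)"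

definition maximal_L_free :: "nat \<Rightarrow> nat set \<Rightarrow> bool" where
  "maximal_L_free n S \<longleftrightarrow>
     S \<subseteq> {1..n} \<and> L_free S \<and> \<not> (\<exists>T. T \<subseteq> {1..n} \<and> L_free T \<and> S \<subset> T)"

definition f_max :: "nat \<Rightarrow> nat" where
  "f_max n = card {S. maximal_L_free n S}"

end

theory Submission
  imports Defs
begin

text \<open>
  Upper bound. Every \<open>L\<close>-free set lies in one of \<open>2 ^ o(n)\<close> containers with \<open>o(n\<^sup>2)\<close> triples, and by
  a removal lemma each container is \<open>B \<union> C\<close> with \<open>B\<close> \<open>L\<close>-free and \<open>|C| = o(n)\<close>. Fix the trace of a
  maximal \<open>S\<close> on \<open>C\<close>. Since \<open>B\<close> has no triples, the rest of \<open>S\<close> is a maximal independent set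
  of the link graph of \<open>S \<inter> C\<close> on \<open>B\<close>. The odd numbers above \<open>n/2\<close> lie in no triple, so they belong to
  every \<open>S\<close> and can be discarded. Put \<open>m = Min B\<close>; the pairs \<open>x, 2 x + 2 m\<close> then show that one of three
  things happens: \<open>|B \<inter> [1, n/2]| \<le> n/4\<close>, and this part determines \<open>S\<close>; or
  \<open>B \<inter> [m, n/2 - m]\<close> together with the even elements of \<open>B\<close> above \<open>n/2\<close> determines \<open>S\<close> and has size at
  most \<open>n/4\<close>; or the link graph has at most \<open>15 n / 32\<close> vertices, and the Moon--Moser bound
  \<open>3 powr (15 n / 96) < 2 powr (n / 4)\<close> is enough.

  Lower bound. Put \<open>1\<close> in \<open>S\<close> and choose one element of each pair \<open>y, 2 y + 2\<close> with \<open>n/4 < y < n/2\<close>: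
  maximal sets extending different choices are different.
\<close>

section \<open>Regularity\<close>

text \<open>Conditional expectation of \<open>f\<close> given the partition of \<open>W\<close> into
  the fibres of \<open>k\<close>. Partitions are encoded as colourings, so a refinement is a
  colouring that determines the coarser one.\<close>

definition cexp :: "'a set \<Rightarrow> ('a \<Rightarrow> 'b) \<Rightarrow> ('a \<Rightarrow> real) \<Rightarrow> 'a \<Rightarrow> real" where
  "cexp W k f w = (\<Sum>u\<in>{u\<in>W. k u = k w}. f u) / real (card {u\<in>W. k u = k w})"

lemma cexp_cong: "k u = k w \<Longrightarrow> cexp W k f u = cexp W k f w"
  by (simp add: cexp_def)

text \<open>Averaging preserves the total of \<open>f\<close> on each fibre, and \<open>h\<close> is
  constant there. In other words, \<open>cexp\<close> is the orthogonal projection onto the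
  functions that are constant on fibres.\<close>

lemma sum_cexp_mult:
  fixes h :: "'a \<Rightarrow> real"
  assumes fin: "finite W"
    and h: "\<And>u w. u \<in> W \<Longrightarrow> w \<in> W \<Longrightarrow> k u = k w \<Longrightarrow> h u = h w"
  shows "(\<Sum>w\<in>W. cexp W k f w * h w) = (\<Sum>w\<in>W. f w * h w)"
proof -
  have fibre: "(\<Sum>w\<in>{w\<in>W. k w = p}. cexp W k f w * h w) = (\<Sum>w\<in>{w\<in>W. k w = p}. f w * h w)"
    if p: "p \<in> k ` W" for p
  proof -
    obtain w0 where w0: "w0 \<in> W" "k w0 = p" using p by auto
    let ?Q = "{w\<in>W. k w = p}"
    have Q: "finite ?Q" "w0 \<in> ?Q" using fin w0 by auto
    then have c: "real (card ?Q) \<noteq> 0" by (metis card_gt_0_iff empty_iff less_irrefl of_nat_0_eq_iff)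
    have hQ: "h w = h w0" if "w \<in> ?Q" for w using that w0 by (intro h) auto
    have "(\<Sum>w\<in>?Q. cexp W k f w * h w) = (\<Sum>w\<in>?Q. sum f ?Q / real (card ?Q) * h w0)"
      by (rule sum.cong) (use hQ in \<open>auto simp: cexp_def\<close>)
    also have "\<dots> = sum f ?Q * h w0" using c by simp
    also have "\<dots> = (\<Sum>w\<in>?Q. f w * h w)"
      unfolding sum_distrib_right by (rule sum.cong) (use hQ in auto)
    finally show ?thesis .
  qed
  have "(\<Sum>w\<in>W. cexp W k f w * h w) = (\<Sum>p\<in>k ` W. \<Sum>w\<in>{w\<in>W. k w = p}. cexp W k f w * h w)"
    by (rule sum.image_gen[OF fin])
  also have "\<dots> = (\<Sum>p\<in>k ` W. \<Sum>w\<in>{w\<in>W. k w = p}. f w * h w)"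
    by (rule sum.cong[OF refl fibre])
  also have "\<dots> = (\<Sum>w\<in>W. f w * h w)"
    by (rule sum.image_gen[OF fin, symmetric])
  finally show ?thesis .
qed

text \<open>Pythagoras: the coarse average is constant on the fine fibres and on its own, so its
  inner products with the fine average and with itself both equal the one with \<open>f\<close>, and
  the cross term collapses.\<close>

lemma sum_cexp_sq_refine:
  assumes fin: "finite W"
    and ref: "\<And>u w. u \<in> W \<Longrightarrow> w \<in> W \<Longrightarrow> k' u = k' w \<Longrightarrow> k u = k w"
  shows "(\<Sum>w\<in>W. (cexp W k' f w)\<^sup>2) =
         (\<Sum>w\<in>W. (cexp W k f w)\<^sup>2) + (\<Sum>w\<in>W. (cexp W k' f w - cexp W k f w)\<^sup>2)"
proof -
  have 1: "(\<Sum>w\<in>W. cexp W k' f w * cexp W k f w) = (\<Sum>w\<in>W. f w * cexp W k f w)"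
    by (rule sum_cexp_mult[OF fin]) (metis ref cexp_cong)
  have 2: "(\<Sum>w\<in>W. cexp W k f w * cexp W k f w) = (\<Sum>w\<in>W. f w * cexp W k f w)"
    by (rule sum_cexp_mult[OF fin]) (metis cexp_cong)
  have "(\<Sum>w\<in>W. (cexp W k' f w - cexp W k f w)\<^sup>2) =
     (\<Sum>w\<in>W. (cexp W k' f w)\<^sup>2) - 2 * (\<Sum>w\<in>W. cexp W k' f w * cexp W k f w)
     + (\<Sum>w\<in>W. cexp W k f w * cexp W k f w)"
    unfolding sum_distrib_left sum_subtractf[symmetric] sum.distrib[symmetric]
    by (rule sum.cong) (simp_all add: power2_eq_square algebra_simps)
  then show ?thesis using 1 2 by (simp add: power2_eq_square)
qed

lemma cexp_bounds:
  assumes "finite W" and "\<And>w. w \<in> W \<Longrightarrow> 0 \<le> f w \<and> f w \<le> 1"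
  shows "0 \<le> cexp W k f w" "cexp W k f w \<le> 1"
proof -
  let ?Q = "{u\<in>W. k u = k w}"
  have "0 \<le> sum f ?Q" using assms by (intro sum_nonneg) auto
  moreover have "sum f ?Q \<le> (\<Sum>u\<in>?Q. 1)" using assms by (intro sum_mono) auto
  ultimately show "0 \<le> cexp W k f w" "cexp W k f w \<le> 1"
    by (auto simp: cexp_def divide_le_eq_1)
qed

section \<open>Energy of a partition and regularity of pairs of classes\<close>

definition pairc :: "('a \<Rightarrow> 'b) \<Rightarrow> 'a \<times> 'a \<Rightarrow> 'b \<times> 'b" where
  "pairc c w = (c (fst w), c (snd w))"

text \<open>The index of Szemeredi's regularity lemma, left unnormalised: for \<open>f\<close> with
  values in the unit interval it is at most \<open>(card V)\<^sup>2\<close>.\<close>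

definition energy :: "'a set \<Rightarrow> ('a \<Rightarrow> 'b) \<Rightarrow> ('a \<times> 'a \<Rightarrow> real) \<Rightarrow> real" where
  "energy V c f = (\<Sum>w\<in>V\<times>V. (cexp (V\<times>V) (pairc c) f w)\<^sup>2)"

lemma energy_le:
  assumes "finite V" and "\<And>w. w \<in> V \<times> V \<Longrightarrow> 0 \<le> f w \<and> f w \<le> 1"
  shows "energy V c f \<le> (real (card V))\<^sup>2"
proof -
  have "energy V c f \<le> (\<Sum>w\<in>V\<times>V. 1)"
    unfolding energy_def
    by (intro sum_mono power_le_one cexp_bounds) (use assms in auto)
  then show ?thesis by (simp add: card_cartesian_product power2_eq_square)
qed

definition dens :: "('a \<times> 'a \<Rightarrow> real) \<Rightarrow> 'a set \<Rightarrow> 'a set \<Rightarrow> real" where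
  "dens f A B = sum f (A \<times> B) / (real (card A) * real (card B))"

text \<open>The one-sided half of regularity: large subsets have no density deficit, which is what a
  lower bound on triangles calls for. Comparing sums instead of densities avoids dividing by the
  size of \<open>A'\<close> or \<open>B'\<close>.\<close>

definition lower_regular :: "real \<Rightarrow> ('a \<times> 'a \<Rightarrow> real) \<Rightarrow> 'a set \<Rightarrow> 'a set \<Rightarrow> bool" where
  "lower_regular \<gamma> f A B \<longleftrightarrow>
     (\<forall>A'\<subseteq>A. \<forall>B'\<subseteq>B. \<gamma> * card A \<le> card A' \<longrightarrow> \<gamma> * card B \<le> card B' \<longrightarrow>
        (dens f A B - \<gamma>) * (real (card A') * real (card B')) \<le> sum f (A' \<times> B'))"

definition cls :: "'a set \<Rightarrow> ('a \<Rightarrow> 'b) \<Rightarrow> 'b \<Rightarrow> 'a set" where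
  "cls V c p = {u\<in>V. c u = p}"

text \<open>Pairs of vertices are collected, not pairs of classes, so an irregular pair of classes
  is weighted by the product of its sizes. This accommodates classes of unequal size.\<close>

definition irreg :: "'a set \<Rightarrow> ('a \<Rightarrow> 'b) \<Rightarrow> real \<Rightarrow> ('a \<times> 'a \<Rightarrow> real) \<Rightarrow> ('a \<times> 'a) set" where
  "irreg V c \<gamma> f = {w\<in>V\<times>V. \<not> lower_regular \<gamma> f (cls V c (c (fst w))) (cls V c (c (snd w)))}"

lemma pairc_fibre: "{u\<in>V\<times>V. pairc c u = (p,q)} = cls V c p \<times> cls V c q"
  by (auto simp: pairc_def cls_def)

lemma cexp_pairc:
  "cexp (V\<times>V) (pairc c) f w = dens f (cls V c (c (fst w))) (cls V c (c (snd w)))"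
  unfolding cexp_def dens_def
  using pairc_fibre[of V c "c (fst w)" "c (snd w)"]
  by (simp add: pairc_def card_cartesian_product)

text \<open>Split every class along all the sets that witness irregularity. An irregular pair of
  classes then gains at least \<gamma>^4 times its size in energy, and such pairs cover more than a
  \<gamma> proportion of \<open>V \<times> V\<close>.\<close>

lemma energy_increment:
  fixes c :: "'a \<Rightarrow> nat"
  assumes fin: "finite V" and \<gamma>: "0 < \<gamma>"
    and irr: "real (card (irreg V c \<gamma> f)) > \<gamma> * (real (card V))\<^sup>2"
  shows "\<exists>c'::'a \<Rightarrow> nat. card (c' ` V) \<le> card (c ` V) * 4 ^ card (c ` V) \<and>
           energy V c' f \<ge> energy V c f + \<gamma>^5 * (real (card V))\<^sup>2"
proof -
  define Cl where "Cl = cls V c"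
  have finCl: "finite (Cl p)" for p using fin by (simp add: Cl_def cls_def)
  have "\<forall>p q. \<exists>A B. \<not> lower_regular \<gamma> f (Cl p) (Cl q) \<longrightarrow> A \<subseteq> Cl p \<and> B \<subseteq> Cl q \<and>
     \<gamma> * card (Cl p) \<le> card A \<and> \<gamma> * card (Cl q) \<le> card B \<and>
     sum f (A \<times> B) < (dens f (Cl p) (Cl q) - \<gamma>) * (real (card A) * real (card B))"
    unfolding lower_regular_def by (meson not_le)
  then obtain A B where AB: "\<And>p q. \<not> lower_regular \<gamma> f (Cl p) (Cl q) \<Longrightarrow>
     A p q \<subseteq> Cl p \<and> B p q \<subseteq> Cl q \<and>
     \<gamma> * card (Cl p) \<le> card (A p q) \<and> \<gamma> * card (Cl q) \<le> card (B p q) \<and>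
     sum f (A p q \<times> B p q) < (dens f (Cl p) (Cl q) - \<gamma>) * (real (card (A p q)) * real (card (B p q)))"
    by metis
  define K where "K = c ` V"
  have finK: "finite K" using fin by (simp add: K_def)
  \<comment> \<open>Besides its old class, a vertex remembers which left and right witness sets
    contain it: at most \<open>2 ^ card K\<close> patterns of each kind, hence the factor
    \<open>4 ^ card K\<close>.\<close>
  define c1 where "c1 = (\<lambda>x. (c x, {q\<in>K. x \<in> A (c x) q}, {p\<in>K. x \<in> B p (c x)}))"
  have c1sub: "c1 ` V \<subseteq> K \<times> Pow K \<times> Pow K" by (auto simp: c1_def K_def)
  have "card (c1 ` V) \<le> card (K \<times> Pow K \<times> Pow K)"
    by (rule card_mono[OF _ c1sub]) (use finK in auto)
  also have "\<dots> = card K * 4 ^ card K"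
    using finK by (simp add: card_cartesian_product card_Pow flip: power_mult_distrib)
  finally have card1: "card (c1 ` V) \<le> card K * 4 ^ card K" .
  \<comment> \<open>Recoding the new classes by natural numbers keeps the type of the colouring
    fixed, so that the increment can be iterated.\<close>
  obtain \<phi> :: "_ \<Rightarrow> nat" where \<phi>: "inj_on \<phi> (c1 ` V)"
    using finite_imp_inj_to_nat_seg[of "c1 ` V"] fin by blast
  define c' where "c' = \<phi> \<circ> c1"
  have c'eq: "c' u = c' w \<longleftrightarrow> c1 u = c1 w" if "u \<in> V" "w \<in> V" for u w
    using \<phi> that by (auto simp: c'_def inj_on_def)
  have cardc': "card (c' ` V) \<le> card K * 4 ^ card K"
    unfolding c'_def image_comp[symmetric] using card1 card_image[OF \<phi>] by simp
  define W where "W = V \<times> V"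
  have finW: "finite W" using fin by (simp add: W_def)
  define g where "g = cexp W (pairc c) f"
  define g' where "g' = cexp W (pairc c') f"
  have en: "energy V c' f = energy V c f + (\<Sum>w\<in>W. (g' w - g w)\<^sup>2)"
    unfolding energy_def g_def g'_def W_def
    by (rule sum_cexp_sq_refine) (use fin c'eq in \<open>auto simp: pairc_def c1_def\<close>)
  define I where "I = irreg V c \<gamma> f"
  have IW: "I \<subseteq> W" by (auto simp: I_def irreg_def W_def)
  have finI: "finite I" using IW finW finite_subset by blast
  have fib: "(\<Sum>w\<in>{w\<in>I. pairc c w = pq}. (g' w - g w)\<^sup>2) \<ge> (\<Sum>w\<in>{w\<in>I. pairc c w = pq}. \<gamma>^4)"
    if pq: "pq \<in> pairc c ` I" for pq
  proof -
    obtain p q where pq': "pq = (p,q)" by (cases pq)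
    have nr: "\<not> lower_regular \<gamma> f (Cl p) (Cl q)" and pK: "p \<in> K" "q \<in> K"
      using pq unfolding pq' by (auto simp: I_def irreg_def pairc_def Cl_def K_def)
    note ab = AB[OF nr]
    have fibeq: "{w\<in>I. pairc c w = pq} = Cl p \<times> Cl q"
      using nr by (auto simp: I_def irreg_def pq' pairc_def Cl_def cls_def)
    define X where "X = A p q \<times> B p q"
    have XW: "X \<subseteq> Cl p \<times> Cl q" using ab by (auto simp: X_def)
    have XW': "X \<subseteq> W" using XW by (auto simp: W_def Cl_def cls_def)
    have finX: "finite X" using XW' finW finite_subset by blast
    have cardX: "real (card X) = real (card (A p q)) * real (card (B p q))"
      by (simp add: X_def card_cartesian_product)
    have gX: "g w = dens f (Cl p) (Cl q)" if "w \<in> X" for w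
      using that XW unfolding g_def W_def cexp_pairc by (auto simp: Cl_def cls_def)
    have lin: "(\<Sum>w\<in>X. - 2 * \<gamma> * t w - \<gamma>\<^sup>2) = - 2 * \<gamma> * sum t X - \<gamma>\<^sup>2 * real (card X)"
      for t :: "'a \<times> 'a \<Rightarrow> real"
      by (simp add: sum_subtractf sum_negf sum_distrib_left)
    have res: "(\<Sum>w\<in>W. F w * of_bool (w \<in> X)) = sum F X" for F :: "'a \<times> 'a \<Rightarrow> real"
      by (rule sum.mono_neutral_cong_right) (use XW' finW in auto)
    \<comment> \<open>\<open>X\<close> is a union of fibres of the refined colouring, so
      \<open>g'\<close> and \<open>f\<close> have the same sum over it.\<close>
    have "(\<Sum>w\<in>W. g' w * of_bool (w \<in> X)) = (\<Sum>w\<in>W. f w * of_bool (w \<in> X))"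
      unfolding g'_def
    proof (rule sum_cexp_mult[OF finW])
      fix u w assume uw: "u \<in> W" "w \<in> W" "pairc c' u = pairc c' w"
      have "c1 (fst u) = c1 (fst w)" "c1 (snd u) = c1 (snd w)"
        using uw c'eq by (auto simp: pairc_def W_def)
      moreover have "fst v \<in> A p q \<longleftrightarrow> c (fst v) = p \<and> q \<in> fst (snd (c1 (fst v)))"
        "snd v \<in> B p q \<longleftrightarrow> c (snd v) = q \<and> p \<in> snd (snd (c1 (snd v)))" for v
        using pK ab by (auto simp: c1_def Cl_def cls_def)
      moreover have "c (fst u) = c (fst w)" "c (snd u) = c (snd w)"
        using calculation(1,2) by (auto simp: c1_def)
      ultimately have "u \<in> X \<longleftrightarrow> w \<in> X"
        by (simp add: X_def mem_Times_iff)
      then show "of_bool (u \<in> X) = (of_bool (w \<in> X) :: real)" by simp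
    qed
    then have sg': "sum g' X = sum f X"
      by (simp add: res)
    have "(\<Sum>w\<in>X. g' w - g w) = sum f X - dens f (Cl p) (Cl q) * real (card X)"
      by (simp add: sum_subtractf sg' gX)
    also have "\<dots> \<le> - \<gamma> * real (card X)"
      using ab unfolding X_def[symmetric] cardX by (simp add: algebra_simps)
    finally have neg: "(\<Sum>w\<in>X. g' w - g w) \<le> - \<gamma> * real (card X)" .
    \<comment> \<open>Instead of Cauchy-Schwarz, the tangent inequality
      \<open>t\<^sup>2 \<ge> - 2 * \<gamma> * t - \<gamma>\<^sup>2\<close> is summed over
      \<open>X\<close>, where \<open>t = g' w - g w\<close> has mean at most -\<gamma> when
      \<open>X\<close> is nonempty.\<close>
    have "\<gamma>^4 * real (card (Cl p \<times> Cl q)) = \<gamma>\<^sup>2 * ((\<gamma> * card (Cl p)) * (\<gamma> * card (Cl q)))"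
      by (simp add: card_cartesian_product power4_eq_xxxx power2_eq_square)
    also have "\<dots> \<le> \<gamma>\<^sup>2 * real (card X)"
      unfolding cardX using ab \<gamma> by (intro mult_left_mono mult_mono) auto
    also have "\<dots> = 2 * \<gamma> * (\<gamma> * real (card X)) - \<gamma>\<^sup>2 * real (card X)"
      by (simp add: power2_eq_square algebra_simps)
    also have "\<dots> \<le> 2 * \<gamma> * (- (\<Sum>w\<in>X. g' w - g w)) - \<gamma>\<^sup>2 * real (card X)"
      using neg \<gamma> by (intro diff_right_mono mult_left_mono) auto
    also have "\<dots> = (\<Sum>w\<in>X. - 2 * \<gamma> * (g' w - g w) - \<gamma>\<^sup>2)"
      using lin[of "\<lambda>w. g' w - g w"] by simp
    also have "\<dots> \<le> (\<Sum>w\<in>X. (g' w - g w)\<^sup>2)"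
    proof (rule sum_mono)
      fix w
      have "0 \<le> (g' w - g w + \<gamma>)\<^sup>2" by simp
      then show "- 2 * \<gamma> * (g' w - g w) - \<gamma>\<^sup>2 \<le> (g' w - g w)\<^sup>2"
        by (simp add: power2_eq_square algebra_simps)
    qed
    also have "\<dots> \<le> (\<Sum>w\<in>Cl p \<times> Cl q. (g' w - g w)\<^sup>2)"
      by (rule sum_mono2) (use finCl XW in auto)
    finally show ?thesis unfolding fibeq by (simp add: mult.commute)
  qed
  have "\<gamma>^5 * (real (card V))\<^sup>2 = \<gamma>^4 * (\<gamma> * (real (card V))\<^sup>2)"
    by (simp add: eval_nat_numeral)
  also have "\<dots> \<le> \<gamma>^4 * real (card I)"
    using irr \<gamma> by (intro mult_left_mono) (auto simp: I_def)
  also have "\<dots> = (\<Sum>w\<in>I. \<gamma>^4)" by simp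
  also have "\<dots> \<le> (\<Sum>w\<in>I. (g' w - g w)\<^sup>2)"
    unfolding sum.image_gen[OF finI, of _ "pairc c"] by (rule sum_mono[OF fib])
  also have "\<dots> \<le> (\<Sum>w\<in>W. (g' w - g w)\<^sup>2)"
    by (rule sum_mono2) (use finW IW in auto)
  finally show ?thesis using cardc' en unfolding K_def by (intro exI[of _ c']) auto
qed

text \<open>Each failure raises the energy by \<gamma>^5 times \<open>(card V)\<^sup>2\<close>, and
  the energy never exceeds \<open>(card V)\<^sup>2\<close>; so the number of refinements, and with
  it \<open>M\<close>, depends on \<gamma> alone.\<close>

lemma regularity:
  assumes \<gamma>: "0 < \<gamma>"
  shows "\<exists>M. \<forall>(V::'a set) f. finite V \<longrightarrow> (\<forall>w\<in>V\<times>V. 0 \<le> f w \<and> f w \<le> 1) \<longrightarrow>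
     (\<exists>c::'a \<Rightarrow> nat. card (c ` V) \<le> M \<and> real (card (irreg V c \<gamma> f)) \<le> \<gamma> * (real (card V))\<^sup>2)"
proof -
  have step: "\<exists>M. \<forall>(V::'a set) f. finite V \<longrightarrow> (\<forall>w\<in>V\<times>V. 0 \<le> f w \<and> f w \<le> 1) \<longrightarrow>
     (\<exists>c::'a \<Rightarrow> nat. card (c ` V) \<le> M \<and> (real (card (irreg V c \<gamma> f)) \<le> \<gamma> * (real (card V))\<^sup>2
          \<or> energy V c f \<ge> real j * \<gamma>^5 * (real (card V))\<^sup>2))" for j :: nat
  proof (induction j)
    case 0
    show ?case
    proof (intro exI[of _ 1] allI impI, goal_cases)
      case (1 V f)
      show ?case
        by (rule exI[of _ "\<lambda>_. 0"]) (auto simp: energy_def intro!: sum_nonneg card_image_le[THEN order_trans] simp: image_constant_conv)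
    qed
  next
    case (Suc j)
    then obtain M where M: "\<And>(V::'a set) f. finite V \<Longrightarrow> (\<forall>w\<in>V\<times>V. 0 \<le> f w \<and> f w \<le> 1) \<Longrightarrow>
     (\<exists>c::'a \<Rightarrow> nat. card (c ` V) \<le> M \<and> (real (card (irreg V c \<gamma> f)) \<le> \<gamma> * (real (card V))\<^sup>2
          \<or> energy V c f \<ge> real j * \<gamma>^5 * (real (card V))\<^sup>2))" by metis
    have MM: "M \<le> M * 4 ^ M" by simp
    show ?case
    proof (intro exI[of _ "M * 4 ^ M"] allI impI, goal_cases)
      case (1 V f)
      obtain c :: "'a \<Rightarrow> nat" where c: "card (c ` V) \<le> M"
        "real (card (irreg V c \<gamma> f)) \<le> \<gamma> * (real (card V))\<^sup>2
          \<or> energy V c f \<ge> real j * \<gamma>^5 * (real (card V))\<^sup>2"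
        using M[OF 1] by blast
      show ?case
      proof (cases "real (card (irreg V c \<gamma> f)) \<le> \<gamma> * (real (card V))\<^sup>2")
        case True
        then show ?thesis using c(1) MM by (meson order_trans)
      next
        case False
        then obtain c' :: "'a \<Rightarrow> nat" where c': "card (c' ` V) \<le> card (c ` V) * 4 ^ card (c ` V)"
           "energy V c' f \<ge> energy V c f + \<gamma>^5 * (real (card V))\<^sup>2"
          using energy_increment[OF 1(1) \<gamma>, of c f] by auto
        have "card (c' ` V) \<le> M * 4 ^ M"
          using c'(1) c(1) by (meson mult_le_mono power_increasing order_trans one_le_numeral)
        moreover have "energy V c' f \<ge> real (Suc j) * \<gamma>^5 * (real (card V))\<^sup>2"
          using c(2) c'(2) False by (auto simp: algebra_simps)
        ultimately show ?thesis by blast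
      qed
    qed
  qed
  obtain j :: nat where j: "real j * \<gamma>^5 > 1"
    using \<gamma> reals_Archimedean3[of "\<gamma>^5"] by (metis zero_less_power)
  obtain M where M: "\<And>(V::'a set) f. finite V \<Longrightarrow> (\<forall>w\<in>V\<times>V. 0 \<le> f w \<and> f w \<le> 1) \<Longrightarrow>
     (\<exists>c::'a \<Rightarrow> nat. card (c ` V) \<le> M \<and> (real (card (irreg V c \<gamma> f)) \<le> \<gamma> * (real (card V))\<^sup>2
          \<or> energy V c f \<ge> real j * \<gamma>^5 * (real (card V))\<^sup>2))" using step[of j] by metis
  show ?thesis
  proof (intro exI[of _ M] allI impI, goal_cases)
    case (1 V f)
    obtain c :: "'a \<Rightarrow> nat" where c: "card (c ` V) \<le> M"
        "real (card (irreg V c \<gamma> f)) \<le> \<gamma> * (real (card V))\<^sup>2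
          \<or> energy V c f \<ge> real j * \<gamma>^5 * (real (card V))\<^sup>2"
      using M[OF 1] by blast
    have "real (card (irreg V c \<gamma> f)) \<le> \<gamma> * (real (card V))\<^sup>2"
    proof (cases "V = {}")
      case True
      then show ?thesis by (simp add: irreg_def)
    next
      case False
      then have "(real (card V))\<^sup>2 > 0" using 1(1) by (simp add: card_gt_0_iff)
      then have "real j * \<gamma>^5 * (real (card V))\<^sup>2 > (real (card V))\<^sup>2"
        using mult_strict_right_mono[OF j, of "(real (card V))\<^sup>2"] by simp
      then show ?thesis using c(2) energy_le[OF 1(1), of f c] 1(2) by force
    qed
    then show ?case using c(1) by blast
  qed
qed

section \<open>Triangle removal\<close>

definition edge_fun :: "('a \<times> 'a) set \<Rightarrow> 'a \<times> 'a \<Rightarrow> real" where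
  "edge_fun E w = of_bool (w \<in> E)"

lemma sum_edge_fun: "finite X \<Longrightarrow> sum (edge_fun E) X = real (card (X \<inter> E))"
  by (simp add: edge_fun_def sum.If_cases of_bool_def)

lemma card_cross:
  assumes "finite A" "finite B"
  shows "card ((A \<times> B) \<inter> E) = (\<Sum>a\<in>A. card {b\<in>B. (a,b) \<in> E})"
proof -
  have "(A \<times> B) \<inter> E = (SIGMA a:A. {b\<in>B. (a,b) \<in> E})" by auto
  then show ?thesis using assms by simp
qed

text \<open>If there were many vertices of low degree, they and the whole of \<open>B\<close> would
  have density below \<gamma>, hence below \<open>dens (edge_fun E) A B - \<gamma>\<close>, against
  regularity.\<close>

lemma few_low_degrees:
  assumes fin: "finite A" "finite B" and ne: "A \<noteq> {}" "B \<noteq> {}"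
    and \<gamma>: "0 < \<gamma>" "\<gamma> \<le> 1"
    and reg: "lower_regular \<gamma> (edge_fun E) A B" and d: "2 * \<gamma> \<le> dens (edge_fun E) A B"
  shows "real (card {a\<in>A. real (card {b\<in>B. (a,b) \<in> E}) < \<gamma> * card B}) < \<gamma> * card A"
proof (rule ccontr)
  let ?A1 = "{a\<in>A. real (card {b\<in>B. (a,b) \<in> E}) < \<gamma> * card B}"
  assume "\<not> ?thesis"
  then have big: "\<gamma> * card A \<le> card ?A1" by simp
  have cB: "real (card B) > 0" and cA: "real (card A) > 0" using fin ne by (auto simp: card_gt_0_iff)
  have "0 < \<gamma> * card A" using cA \<gamma> by simp
  then have "card ?A1 \<noteq> 0" using big by linarith
  then have A1: "finite ?A1" "?A1 \<noteq> {}" by (auto intro: card_ge_0_finite simp: card_eq_0_iff)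
  have "(dens (edge_fun E) A B - \<gamma>) * (real (card ?A1) * real (card B)) \<le> sum (edge_fun E) (?A1 \<times> B)"
    using reg big \<gamma> unfolding lower_regular_def
    by (elim allE[of _ ?A1] impE allE[of _ B]) (auto simp: mult_left_le_one_le)
  also have "\<dots> = (\<Sum>a\<in>?A1. real (card {b\<in>B. (a,b) \<in> E}))"
    using fin A1 by (simp add: sum_edge_fun card_cross)
  also have "\<dots> < (\<Sum>a\<in>?A1. \<gamma> * card B)"
    by (rule sum_strict_mono) (use A1 in auto)
  also have "\<dots> = \<gamma> * (real (card ?A1) * real (card B))" by simp
  also have "\<dots> \<le> (dens (edge_fun E) A B - \<gamma>) * (real (card ?A1) * real (card B))"
    using d by (intro mult_right_mono) auto
  finally show False by simp
qed

text \<open>At least half of the vertices of \<open>A\<close> have many neighbours in both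
  \<open>B\<close> and \<open>C\<close>. For such a vertex, regularity of \<open>B\<close> and
  \<open>C\<close> applied to the two neighbourhoods yields
  \<open>\<gamma>^3 * card B * card C\<close> triangles.\<close>

lemma triangle_counting:
  assumes fin: "finite A" "finite B" "finite C" and ne: "A \<noteq> {}" "B \<noteq> {}" "C \<noteq> {}"
    and \<gamma>: "0 < \<gamma>" "\<gamma> \<le> 1/4"
    and AB: "lower_regular \<gamma> (edge_fun E) A B" "2 * \<gamma> \<le> dens (edge_fun E) A B"
    and AC: "lower_regular \<gamma> (edge_fun E) A C" "2 * \<gamma> \<le> dens (edge_fun E) A C"
    and BC: "lower_regular \<gamma> (edge_fun E) B C" "2 * \<gamma> \<le> dens (edge_fun E) B C"
  shows "\<gamma>^3 / 2 * (real (card A) * real (card B) * real (card C)) \<le>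
    real (card {(x,y,z). x \<in> A \<and> y \<in> B \<and> z \<in> C \<and> (x,y) \<in> E \<and> (y,z) \<in> E \<and> (x,z) \<in> E})"
proof -
  define NB where "NB a = {b\<in>B. (a,b) \<in> E}" for a
  define NC where "NC a = {b\<in>C. (a,b) \<in> E}" for a
  define A1 where "A1 = {a\<in>A. real (card (NB a)) < \<gamma> * card B}"
  define A2 where "A2 = {a\<in>A. real (card (NC a)) < \<gamma> * card C}"
  have finN: "finite (NB a)" "finite (NC a)" for a using fin by (auto simp: NB_def NC_def)
  have cards: "real (card A1) < \<gamma> * card A" "real (card A2) < \<gamma> * card A"
    unfolding A1_def A2_def NB_def NC_def
    using few_low_degrees[OF fin(1,2) ne(1,2) \<gamma>(1) _ AB] few_low_degrees[OF fin(1,3) ne(1,3) \<gamma>(1) _ AC] \<gamma>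
    by auto
  define A0 where "A0 = A - (A1 \<union> A2)"
  have subA: "A1 \<union> A2 \<subseteq> A" by (auto simp: A1_def A2_def)
  have "real (card (A1 \<union> A2)) \<le> real (card A1) + real (card A2)"
    using card_Un_le[of A1 A2] by linarith
  moreover have "\<gamma> * card A \<le> (1/4) * card A" using \<gamma> by (intro mult_right_mono) auto
  moreover have "real (card A0) = real (card A) - real (card (A1 \<union> A2))"
    unfolding A0_def using fin(1) subA finite_subset[OF subA fin(1)]
    by (subst card_Diff_subset) (auto intro!: of_nat_diff card_mono)
  ultimately have A0: "real (card A0) \<ge> real (card A) / 2" using cards by linarith
  have finA0: "finite A0" using fin by (simp add: A0_def)
  have loc: "\<gamma>^3 * (real (card B) * real (card C)) \<le> real (card ((NB a \<times> NC a) \<inter> E))" if a: "a \<in> A0" for a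
  proof -
    have nb: "\<gamma> * card B \<le> card (NB a)" and nc: "\<gamma> * card C \<le> card (NC a)"
      using a by (auto simp: A0_def A1_def A2_def)
    have "\<gamma>^3 * (real (card B) * real (card C)) = \<gamma> * ((\<gamma> * card B) * (\<gamma> * card C))"
      by (simp add: eval_nat_numeral)
    also have "\<dots> \<le> \<gamma> * (real (card (NB a)) * real (card (NC a)))"
      using nb nc \<gamma> by (intro mult_left_mono mult_mono) auto
    also have "\<dots> \<le> (dens (edge_fun E) B C - \<gamma>) * (real (card (NB a)) * real (card (NC a)))"
      using BC(2) by (intro mult_right_mono) auto
    also have "\<dots> \<le> sum (edge_fun E) (NB a \<times> NC a)"
      by (rule BC(1)[unfolded lower_regular_def, rule_format]) (use nb nc in \<open>auto simp: NB_def NC_def\<close>)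
    finally show ?thesis using finN by (simp add: sum_edge_fun)
  qed
  have "\<gamma>^3 / 2 * (real (card A) * real (card B) * real (card C))
      = (real (card A) / 2) * (\<gamma>^3 * (real (card B) * real (card C)))" by simp
  also have "\<dots> \<le> real (card A0) * (\<gamma>^3 * (real (card B) * real (card C)))"
    using A0 \<gamma> by (intro mult_right_mono) auto
  also have "\<dots> = (\<Sum>a\<in>A0. \<gamma>^3 * (real (card B) * real (card C)))" by simp
  also have "\<dots> \<le> (\<Sum>a\<in>A0. real (card ((NB a \<times> NC a) \<inter> E)))"
    by (rule sum_mono[OF loc])
  also have "\<dots> = real (card (SIGMA a:A0. (NB a \<times> NC a) \<inter> E))"
    using finA0 finN by (subst card_SigmaI) auto
  also have "\<dots> \<le> real (card {(x,y,z). x \<in> A \<and> y \<in> B \<and> z \<in> C \<and> (x,y) \<in> E \<and> (y,z) \<in> E \<and> (x,z) \<in> E})"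
  proof (intro of_nat_mono card_mono)
    show "finite {(x,y,z). x \<in> A \<and> y \<in> B \<and> z \<in> C \<and> (x,y) \<in> E \<and> (y,z) \<in> E \<and> (x,z) \<in> E}"
      by (rule finite_subset[of _ "A \<times> B \<times> C"]) (use fin in auto)
  qed (auto simp: A0_def NB_def NC_def)
  finally show ?thesis .
qed

text \<open>\<open>R\<close> collects the pairs that are irregular, the edges between sparse pairs
  of classes, and the pairs meeting a small class. A triangle avoiding \<open>R\<close> sits on
  three dense regular pairs of large classes, and counting then produces too many triangles.
  Triangles are ordered and the three classes may coincide.\<close>

lemma triangle_removal:
  assumes \<rho>: "0 < \<rho>"
  shows "\<exists>\<delta>>0. \<forall>(V::'a set) E. finite V \<longrightarrow> E \<subseteq> V \<times> V \<longrightarrow>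
     real (card {(x,y,z). (x,y) \<in> E \<and> (y,z) \<in> E \<and> (x,z) \<in> E}) \<le> \<delta> * real (card V)^3 \<longrightarrow>
     (\<exists>R\<subseteq>V \<times> V. real (card R) \<le> \<rho> * (real (card V))\<^sup>2 \<and>
        (\<forall>x y z. (x,y) \<in> E \<longrightarrow> (y,z) \<in> E \<longrightarrow> (x,z) \<in> E \<longrightarrow> (x,y) \<in> R \<or> (y,z) \<in> R \<or> (x,z) \<in> R))"
proof -
  \<comment> \<open>Five shares of \<gamma>: one for irregular pairs, two for sparse pairs, and one
    for each coordinate that may lie in a small class. The bound 1/4 comes from
    \<open>triangle_counting\<close>.\<close>
  define \<gamma> where "\<gamma> = min (\<rho> / 5) (1/4)"
  have \<gamma>: "0 < \<gamma>" "\<gamma> \<le> 1/4" "5 * \<gamma> \<le> \<rho>" using \<rho> by (auto simp: \<gamma>_def)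
  obtain M0 where M0: "\<And>(V::'a set) f. finite V \<Longrightarrow> (\<forall>w\<in>V\<times>V. 0 \<le> f w \<and> f w \<le> 1) \<Longrightarrow>
     (\<exists>c::'a \<Rightarrow> nat. card (c ` V) \<le> M0 \<and> real (card (irreg V c \<gamma> f)) \<le> \<gamma> * (real (card V))\<^sup>2)"
    using regularity[OF \<gamma>(1)] by metis
  define M where "M = real (max M0 1)"
  have M: "M \<ge> 1" "real M0 \<le> M" by (auto simp: M_def)
  \<comment> \<open>Half of what \<open>triangle_counting\<close> guarantees for three classes of
    proportion \<open>\<gamma> / M\<close>, so that the final comparison is strict.\<close>
  define \<delta> where "\<delta> = \<gamma>^3 / 4 * (\<gamma> / M)^3"
  have \<delta>: "\<delta> > 0" using \<gamma> M by (simp add: \<delta>_def)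
  show ?thesis
  proof (intro exI[of _ \<delta>] conjI allI impI \<delta>, goal_cases)
    case (1 V E)
    define N where "N = real (card V)"
    define f where "f = edge_fun E"
    have fb: "\<forall>w\<in>V\<times>V. 0 \<le> f w \<and> f w \<le> 1" by (simp add: f_def edge_fun_def)
    obtain c :: "'a \<Rightarrow> nat" where c: "card (c ` V) \<le> M0"
       "real (card (irreg V c \<gamma> f)) \<le> \<gamma> * N\<^sup>2"
      using M0[OF 1(1) fb] unfolding N_def by blast
    define Cl where "Cl x = cls V c (c x)" for x
    have finCl: "finite (Cl x)" for x using 1(1) by (simp add: Cl_def cls_def)
    define d where "d w = dens f (Cl (fst w)) (Cl (snd w))" for w
    define Low where "Low = {w\<in>V\<times>V. d w < 2 * \<gamma>}"
    define Sm where "Sm = {x\<in>V. real (card (Cl x)) < \<gamma> * N / M}"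
    define R where "R = irreg V c \<gamma> f \<union> (Low \<inter> E) \<union> (Sm \<times> V) \<union> (V \<times> Sm)"
    have finW: "finite (V \<times> V)" using 1(1) by simp
    have LowV: "Low \<subseteq> V \<times> V" by (auto simp: Low_def)
    have finLow: "finite Low" using LowV finW finite_subset by blast
    \<comment> \<open>\<open>Low\<close> is a union of products of classes, so the number of edges
      in it is the sum of the class densities over it.\<close>
    have "(\<Sum>w\<in>V\<times>V. cexp (V\<times>V) (pairc c) f w * of_bool (w \<in> Low)) = (\<Sum>w\<in>V\<times>V. f w * of_bool (w \<in> Low))"
      by (rule sum_cexp_mult[OF finW]) (auto simp: Low_def d_def Cl_def pairc_def)
    moreover have "(\<Sum>w\<in>V\<times>V. F w * of_bool (w \<in> Low)) = sum F Low" for F :: "'a \<times> 'a \<Rightarrow> real"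
      by (rule sum.mono_neutral_cong_right) (use finW LowV in auto)
    ultimately have "sum f Low = sum (cexp (V\<times>V) (pairc c) f) Low" by simp
    also have "\<dots> = sum d Low" by (simp add: cexp_pairc d_def Cl_def)
    also have "\<dots> \<le> (\<Sum>w\<in>Low. 2 * \<gamma>)" by (rule sum_mono) (auto simp: Low_def)
    also have "\<dots> \<le> 2 * \<gamma> * real (card (V \<times> V))"
      using card_mono[OF finW LowV] \<gamma> by simp
    finally have low: "real (card (Low \<inter> E)) \<le> 2 * \<gamma> * N\<^sup>2"
      using finLow by (simp add: f_def sum_edge_fun N_def card_cartesian_product power2_eq_square)
    define P where "P = {p\<in>c ` V. real (card (cls V c p)) < \<gamma> * N / M}"
    have finP: "finite P" using 1(1) by (simp add: P_def)
    have "Sm = (\<Union>p\<in>P. cls V c p)"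
      by (auto simp: Sm_def Cl_def cls_def P_def)
    then have "card Sm \<le> (\<Sum>p\<in>P. card (cls V c p))"
      using card_UN_le[OF finP] by simp
    then have "real (card Sm) \<le> real (\<Sum>p\<in>P. card (cls V c p))"
      by (rule of_nat_mono)
    also have "\<dots> = (\<Sum>p\<in>P. real (card (cls V c p)))" by simp
    also have "\<dots> \<le> (\<Sum>p\<in>P. \<gamma> * N / M)"
      by (rule sum_mono) (auto simp: P_def)
    also have "\<dots> = real (card P) * (\<gamma> * N / M)" by simp
    also have "\<dots> \<le> real (card (c ` V)) * (\<gamma> * N / M)"
      by (intro mult_right_mono of_nat_mono card_mono) (use 1(1) \<gamma> M in \<open>auto simp: N_def P_def\<close>)
    also have "\<dots> \<le> M * (\<gamma> * N / M)"
      using c(1) M \<gamma> by (intro mult_right_mono) (auto simp: N_def)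
    also have "\<dots> = \<gamma> * N" using M by simp
    finally have sm: "real (card Sm) \<le> \<gamma> * N" .
    have smV: "real (card (Sm \<times> V)) \<le> \<gamma> * N\<^sup>2" "real (card (V \<times> Sm)) \<le> \<gamma> * N\<^sup>2"
      using mult_right_mono[OF sm, of N] by (auto simp: card_cartesian_product N_def power2_eq_square mult_ac)
    have "card R \<le> card (irreg V c \<gamma> f) + card (Low \<inter> E) + card (Sm \<times> V) + card (V \<times> Sm)"
      unfolding R_def by (meson add_le_mono card_Un_le le_trans order_refl)
    then have "real (card R) \<le> real (card (irreg V c \<gamma> f)) + real (card (Low \<inter> E)) + real (card (Sm \<times> V)) + real (card (V \<times> Sm))"
      by linarith
    also have "\<dots> \<le> (5 * \<gamma>) * N\<^sup>2" using c(2) low smV by (simp add: algebra_simps)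
    also have "\<dots> \<le> \<rho> * N\<^sup>2" using \<gamma>(3) by (intro mult_right_mono) auto
    finally have cR: "real (card R) \<le> \<rho> * N\<^sup>2" .
    have RV: "R \<subseteq> V \<times> V" by (auto simp: R_def irreg_def Low_def Sm_def)
    have tri: "(x,y) \<in> R \<or> (y,z) \<in> R \<or> (x,z) \<in> R"
      if E: "(x,y) \<in> E" "(y,z) \<in> E" "(x,z) \<in> E" for x y z
    proof (rule ccontr)
      assume nR: "\<not> ?thesis"
      have V: "x \<in> V" "y \<in> V" "z \<in> V" using E 1(2) by auto
      have Npos: "N > 0" using V 1(1) by (auto simp: N_def card_gt_0_iff)
      have reg: "lower_regular \<gamma> f (Cl x) (Cl y)" "lower_regular \<gamma> f (Cl y) (Cl z)" "lower_regular \<gamma> f (Cl x) (Cl z)"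
        using nR V by (auto simp: R_def irreg_def Cl_def)
      have dn: "2 * \<gamma> \<le> dens f (Cl x) (Cl y)" "2 * \<gamma> \<le> dens f (Cl y) (Cl z)" "2 * \<gamma> \<le> dens f (Cl x) (Cl z)"
        using nR V E by (auto simp: R_def Low_def d_def)
      have sz: "\<gamma> * N / M \<le> card (Cl x)" "\<gamma> * N / M \<le> card (Cl y)" "\<gamma> * N / M \<le> card (Cl z)"
        using nR V by (auto simp: R_def Sm_def)
      have ne: "Cl x \<noteq> {}" "Cl y \<noteq> {}" "Cl z \<noteq> {}" using V by (auto simp: Cl_def cls_def)
      have p: "0 \<le> \<gamma> * N / M" using \<gamma> M Npos by simp
      have "\<gamma>^3 / 2 * ((\<gamma> * N / M) * (\<gamma> * N / M) * (\<gamma> * N / M)) \<le>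
         \<gamma>^3 / 2 * (real (card (Cl x)) * real (card (Cl y)) * real (card (Cl z)))"
        using sz p \<gamma> by (intro mult_left_mono mult_mono) auto
      also have "\<dots> \<le> real (card {(u,v,w). u \<in> Cl x \<and> v \<in> Cl y \<and> w \<in> Cl z \<and> (u,v) \<in> E \<and> (v,w) \<in> E \<and> (u,w) \<in> E})"
        by (rule triangle_counting[OF finCl finCl finCl ne \<gamma>(1,2)])
           (use reg dn in \<open>auto simp: f_def\<close>)
      also have "\<dots> \<le> real (card {(x,y,z). (x,y) \<in> E \<and> (y,z) \<in> E \<and> (x,z) \<in> E})"
      proof (intro of_nat_mono card_mono)
        show "finite {(x,y,z). (x,y) \<in> E \<and> (y,z) \<in> E \<and> (x,z) \<in> E}"
          by (rule finite_subset[of _ "V \<times> V \<times> V"]) (use 1 in auto)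
      qed auto
      also have "\<dots> \<le> \<delta> * N^3" using 1(3) by (simp add: N_def)
      finally have "2 * (\<delta> * N^3) \<le> \<delta> * N^3"
        by (simp add: \<delta>_def eval_nat_numeral field_simps)
      moreover have "\<delta> * N^3 > 0" using \<delta> Npos by simp
      ultimately show False by linarith
    qed
    show ?case using RV cR tri unfolding N_def by blast
  qed
qed

section \<open>Containers\<close>

text \<open>The equation with the roles of its variables forgotten: the edge relation of a symmetric
  3-uniform hypergraph, with repetitions allowed. Links of vertices thereby become undirected
  graphs.\<close>

definition triad :: "nat \<Rightarrow> nat \<Rightarrow> nat \<Rightarrow> bool" where
  "triad a b c \<longleftrightarrow> c = 2 * a + 2 * b \<or> b = 2 * a + 2 * c \<or> a = 2 * b + 2 * c"

lemma triad_swap: "triad a b c \<longleftrightarrow> triad b a c" "triad a b c \<longleftrightarrow> triad a c b"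
  by (auto simp: triad_def)

lemma L_free_triad: "L_free S \<longleftrightarrow> \<not> (\<exists>a\<in>S. \<exists>b\<in>S. \<exists>c\<in>S. triad a b c)"
  unfolding L_free_def triad_def by metis

text \<open>One candidate for each position that \<open>c\<close> can take in the equation. This
  bounded codegree keeps the degrees of the link graph under control.\<close>

lemma triad_codegree: "finite {c. triad a b c}" "card {c. triad a b c} \<le> 3"
proof -
  have sub: "{c. triad a b c} \<subseteq> {2 * a + 2 * b, b div 2 - a, a div 2 - b}"
    by (auto simp: triad_def)
  then show "finite {c. triad a b c}" by (rule finite_subset) simp
  have "card {c. triad a b c} \<le> card {2 * a + 2 * b, b div 2 - a, a div 2 - b}"
    by (rule card_mono[OF _ sub]) simp
  also have "\<dots> \<le> 3" by (simp add: card_insert_if)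
  finally show "card {c. triad a b c} \<le> 3" .
qed

definition triads :: "nat set \<Rightarrow> (nat \<times> nat \<times> nat) set" where
  "triads F = {(x,y,z). x \<in> F \<and> y \<in> F \<and> z \<in> F \<and> triad x y z}"

definition nbrs :: "nat set \<Rightarrow> nat set \<Rightarrow> nat \<Rightarrow> nat set" where
  "nbrs F T x = {y\<in>F. \<exists>t\<in>T. triad t x y}"

text \<open>Ordered pairs: an edge between distinct vertices counts twice, a loop once.\<close>

definition link :: "nat set \<Rightarrow> nat set \<Rightarrow> (nat \<times> nat) set" where
  "link F T = {(x,y). x \<in> F \<and> y \<in> F \<and> (\<exists>t\<in>T. triad t x y)}"

text \<open>
  Potential of the branching algorithm. Answering ``\<open>v \<in> S\<close>'' lowers it by at least \<open>1\<close>: either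
  \<open>v\<close> has at least \<open>D\<close> neighbours in the link graph, which all leave \<open>F\<close>, or \<open>v\<close> joins \<open>T\<close> and
  creates at least \<open>\<mu>\<close> new edges. Degrees stay at most \<open>D + 3\<close>, so deleting a vertex never raises it.
\<close>

definition budget :: "nat \<Rightarrow> real \<Rightarrow> nat set \<Rightarrow> nat set \<Rightarrow> real" where
  "budget D \<mu> F T = real (card F) / real D
     + (2 * real (D + 3) * real (card F) - real (card (link F T))) / \<mu>"

lemma link_Sigma: "link F T = (SIGMA x:F. nbrs F T x)"
  by (auto simp: link_def nbrs_def)

lemma finite_link [simp]: "finite F \<Longrightarrow> finite (link F T)"
  by (simp add: link_Sigma nbrs_def)

lemma finite_nbrs [simp]: "finite F \<Longrightarrow> finite (nbrs F T x)"
  by (simp add: nbrs_def)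

lemma card_link_le:
  assumes "finite F" and "\<And>x. x \<in> F \<Longrightarrow> card (nbrs F T x) \<le> d"
  shows "card (link F T) \<le> d * card F"
proof -
  have "card (link F T) = (\<Sum>x\<in>F. card (nbrs F T x))"
    using assms(1) by (simp add: link_Sigma)
  also have "\<dots> \<le> (\<Sum>x\<in>F. d)" by (rule sum_mono) (use assms in auto)
  finally show ?thesis by (simp add: mult.commute)
qed

lemma budget_nonneg:
  assumes "finite F" and "\<And>x. x \<in> F \<Longrightarrow> card (nbrs F T x) \<le> D + 3" and "0 < \<mu>"
  shows "0 \<le> budget D \<mu> F T"
proof -
  have "real (card (link F T)) \<le> real ((D + 3) * card F)"
    by (intro of_nat_mono card_link_le assms)
  also have "\<dots> \<le> 2 * real (D + 3) * real (card F)"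
    unfolding of_nat_mult by (intro mult_right_mono) auto
  finally show ?thesis using assms(3) by (simp add: budget_def)
qed

text \<open>Each deleted vertex destroys at most \<open>2 * (D + 3)\<close> ordered link pairs, one
  factor \<open>D + 3\<close> for each coordinate; the second term of the potential has exactly this
  slope in \<open>card F\<close>, so the whole decrease of the first term survives.\<close>

lemma budget_subset:
  assumes fin: "finite F" and deg: "\<And>x. x \<in> F \<Longrightarrow> card (nbrs F T x) \<le> D + 3"
    and sub: "F0 \<subseteq> F" and \<mu>: "0 < \<mu>"
  shows "budget D \<mu> F0 T + real (card (F - F0)) / real D \<le> budget D \<mu> F T"
proof -
  have finD: "finite (F - F0)" and finF0: "finite F0" using fin sub finite_subset by auto
  define X where "X = (SIGMA x:F - F0. nbrs F T x)"
  have finX: "finite X" using fin by (simp add: X_def)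
  have "card X = (\<Sum>x\<in>F - F0. card (nbrs F T x))"
    using fin by (simp add: X_def)
  also have "\<dots> \<le> (\<Sum>x\<in>F - F0. D + 3)" by (rule sum_mono) (use deg in auto)
  finally have cX: "card X \<le> card (F - F0) * (D + 3)" by simp
  have "link F T \<subseteq> link F0 T \<union> X \<union> prod.swap ` X"
  proof
    fix w assume w: "w \<in> link F T"
    obtain x y where xy: "w = (x,y)" by (cases w)
    show "w \<in> link F0 T \<union> X \<union> prod.swap ` X"
    proof (cases "x \<in> F0 \<and> y \<in> F0")
      case True
      then show ?thesis using w by (auto simp: xy link_def)
    next
      case False
      then have "(x,y) \<in> X \<or> (y,x) \<in> X"
        using w triad_swap(2) by (auto simp: xy link_def X_def nbrs_def)
      then show ?thesis unfolding xy by (metis UnI1 UnI2 image_eqI swap_simp)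
    qed
  qed
  then have "card (link F T) \<le> card (link F0 T \<union> X \<union> prod.swap ` X)"
    using finX finF0 by (intro card_mono) auto
  also have "\<dots> \<le> card (link F0 T) + card X + card (prod.swap ` X)"
    by (meson add_le_mono1 card_Un_le le_trans)
  also have "\<dots> \<le> card (link F0 T) + 2 * (card (F - F0) * (D + 3))"
    using cX card_image_le[OF finX, of prod.swap] by linarith
  finally have "real (card (link F T)) \<le> real (card (link F0 T) + 2 * (card (F - F0) * (D + 3)))"
    by (rule of_nat_mono)
  then have l: "real (card (link F T)) \<le> real (card (link F0 T)) + 2 * real (D + 3) * real (card (F - F0))"
    by (simp add: algebra_simps)
  have c: "real (card F) = real (card F0) + real (card (F - F0))"
    using fin sub by (simp add: card_Diff_subset finite_subset card_mono of_nat_diff)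
  have "(2 * real (D + 3) * real (card F0) - real (card (link F0 T))) / \<mu>
      \<le> (2 * real (D + 3) * real (card F) - real (card (link F T))) / \<mu>"
    using l \<mu> unfolding c by (intro divide_right_mono) (auto simp: algebra_simps)
  moreover have "real (card F) / real D = real (card F0) / real D + real (card (F - F0)) / real D"
    unfolding c by (simp add: add_divide_distrib)
  ultimately show ?thesis unfolding budget_def by linarith
qed

definition new_pairs :: "nat set \<Rightarrow> nat set \<Rightarrow> nat \<Rightarrow> (nat \<times> nat) set" where
  "new_pairs F T v = {(x,y). x \<in> F - {v} \<and> y \<in> F - {v} \<and> triad v x y \<and> (x,y) \<notin> link F T}"

text \<open>This bounds the triads left when the branching stops. For fixed \<open>v\<close>, the
  completing pairs are new (at most \<mu>) or contain \<open>v\<close> (at most 6) or are already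
  link pairs; the last kind is counted from the link, each pair of which extends in at most 3
  ways.\<close>

lemma card_triads_le:
  assumes fin: "finite F" and deg: "\<And>x. x \<in> F \<Longrightarrow> card (nbrs F T x) \<le> d"
    and new: "\<And>v. v \<in> F \<Longrightarrow> real (card (new_pairs F T v)) \<le> \<mu>"
  shows "real (card (triads F)) \<le> real (card F) * (\<mu> + 6 + 3 * real d)"
proof -
  define Y where "Y v = new_pairs F T v \<union> {v} \<times> {y. triad v v y} \<union> {y. triad v v y} \<times> {v}" for v
  have finNew: "finite (new_pairs F T v)" for v
    by (rule finite_subset[of _ "F \<times> F"]) (use fin in \<open>auto simp: new_pairs_def\<close>)
  have finY: "finite (Y v)" for v
    using finNew triad_codegree(1) by (simp add: Y_def)
  have cY: "real (card (Y v)) \<le> \<mu> + 6" if "v \<in> F" for v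
  proof -
    have "card (Y v) \<le> card (new_pairs F T v) + card ({v} \<times> {y. triad v v y}) + card ({y. triad v v y} \<times> {v})"
      unfolding Y_def by (meson add_le_mono1 card_Un_le le_trans)
    also have "\<dots> \<le> card (new_pairs F T v) + 3 + 3"
      using triad_codegree(2)[of v v] by (simp add: card_cartesian_product)
    finally show ?thesis using new[OF that] by linarith
  qed
  define Z where "Z = (SIGMA w:link F T. {v. triad (fst w) (snd w) v})"
  have finZ: "finite Z" using fin triad_codegree(1) by (simp add: Z_def)
  have "card Z = (\<Sum>w\<in>link F T. card {v. triad (fst w) (snd w) v})"
    using fin triad_codegree(1) by (simp add: Z_def)
  also have "\<dots> \<le> (\<Sum>w\<in>link F T. 3)" by (intro sum_mono triad_codegree(2))
  also have "\<dots> \<le> 3 * (d * card F)" using card_link_le[OF fin deg] by simp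
  finally have cZ: "card Z \<le> 3 * (d * card F)" .
  have "triads F \<subseteq> (SIGMA v:F. Y v) \<union> (\<lambda>(w,v). (v, w)) ` Z"
  proof
    fix p assume p: "p \<in> triads F"
    obtain v x y where vxy: "p = (v,x,y)" by (cases p) auto
    have tr: "v \<in> F" "x \<in> F" "y \<in> F" "triad v x y" using p by (auto simp: vxy triads_def)
    have tr': "triad x y v" using tr(4) triad_swap by blast
    show "p \<in> (SIGMA v:F. Y v) \<union> (\<lambda>(w,v). (v, w)) ` Z"
    proof (cases "(x,y) \<in> link F T")
      case True
      then have "((x,y),v) \<in> Z" using tr' by (simp add: Z_def)
      then show ?thesis unfolding vxy by (intro UnI2 image_eqI[where x = "((x,y),v)"]) auto
    next
      case False
      have "x = v \<Longrightarrow> triad v v y" "y = v \<Longrightarrow> triad v v x" using tr(4) triad_swap by blast+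
      then show ?thesis using tr False by (auto simp: vxy Y_def new_pairs_def)
    qed
  qed
  then have "card (triads F) \<le> card ((SIGMA v:F. Y v) \<union> (\<lambda>(w,v). (v, w)) ` Z)"
    using finZ finY fin by (intro card_mono) auto
  also have "\<dots> \<le> card (SIGMA v:F. Y v) + card Z"
    by (meson add_le_mono card_Un_le card_image_le finZ le_trans order_refl)
  also have "\<dots> \<le> (\<Sum>v\<in>F. card (Y v)) + 3 * (d * card F)"
    using cZ fin finY by simp
  finally have "real (card (triads F)) \<le> real ((\<Sum>v\<in>F. card (Y v)) + 3 * (d * card F))"
    by (rule of_nat_mono)
  also have "\<dots> = (\<Sum>v\<in>F. real (card (Y v))) + 3 * (real d * real (card F))" by simp
  also have "\<dots> \<le> (\<Sum>v\<in>F. \<mu> + 6) + 3 * (real d * real (card F))"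
    using cY by (intro add_right_mono sum_mono) auto
  finally show ?thesis by (simp add: algebra_simps)
qed

section \<open>The branching algorithm and its leaves\<close>

definition covers :: "(nat set \<times> nat set) set \<Rightarrow> nat set \<Rightarrow> nat set \<Rightarrow> bool" where
  "covers \<F> A U \<longleftrightarrow> (\<forall>S. L_free S \<longrightarrow> A \<subseteq> S \<longrightarrow> S \<subseteq> U \<longrightarrow> (\<exists>(B,T)\<in>\<F>. S \<subseteq> B \<union> T))"

text \<open>
  \<open>T1\<close> and \<open>T2\<close> are the elements already known to lie in \<open>S\<close>; only those of \<open>T2\<close> contribute edges,
  which keeps the degrees bounded. In the bound on the number of leaves, the two branches on \<open>v\<close> add up to
  the factor \<open>1 + 1 / \<beta> \<le> \<alpha>\<close>.
\<close>

lemma branching: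
  fixes D :: nat and \<mu> \<alpha> \<beta> K :: real
  assumes D: "D \<ge> 1" and \<mu>: "0 < \<mu>" and \<beta>: "\<beta> \<ge> 1" and \<alpha>: "1 + 1 / \<beta> \<le> \<alpha>"
    and K: "K = \<mu> + 6 + 3 * real (D + 3)"
  shows "finite F \<Longrightarrow> finite T1 \<Longrightarrow> finite T2 \<Longrightarrow> (\<And>x. x \<in> F \<Longrightarrow> card (nbrs F T2 x) \<le> D + 3) \<Longrightarrow>
    \<exists>\<F>. finite \<F> \<and> real (card \<F>) \<le> \<alpha> ^ card F * \<beta> powr budget D \<mu> F T2 \<and>
      (\<forall>(B,T)\<in>\<F>. B \<subseteq> F \<and> finite T \<and> real (card T) \<le> real (card (T1 \<union> T2)) + budget D \<mu> F T2
          \<and> real (card (triads B)) \<le> real (card F) * K) \<and>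
      covers \<F> T2 (F \<union> T1 \<union> T2)"
proof (induction "card F" arbitrary: F T1 T2 rule: less_induct)
  case less
  note fin = less.prems(1-3) and deg = less.prems(4)
  have Kpos: "K > 0" using K \<mu> by simp
  have \<alpha>1: "\<alpha> \<ge> 1" using \<alpha> \<beta> by (smt (verit) divide_nonneg_nonneg)
  define b where "b = budget D \<mu> F T2"
  have b0: "b \<ge> 0" unfolding b_def by (rule budget_nonneg) (use fin deg \<mu> in auto)
  \<comment> \<open>Bookkeeping common to both kinds of branching: the answer "no" only deletes
    \<open>v\<close>, while "yes" passes to \<open>F2\<close>, \<open>T1'\<close>,
    \<open>T2'\<close> at the price of one unit of potential.\<close>
  have branch: ?case
    if v: "v \<in> F" and F2: "F2 \<subseteq> F - {v}" and fin2: "finite T1'" "finite T2'" and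
      deg2: "\<And>x. x \<in> F2 \<Longrightarrow> card (nbrs F2 T2' x) \<le> D + 3" and
      bud2: "budget D \<mu> F2 T2' \<le> b - 1" and T': "T1' \<union> T2' = insert v (T1 \<union> T2)" and
      yes: "\<And>S. L_free S \<Longrightarrow> T2 \<subseteq> S \<Longrightarrow> S \<subseteq> F \<union> T1 \<union> T2 \<Longrightarrow> v \<in> S \<Longrightarrow> T2' \<subseteq> S \<and> S \<subseteq> F2 \<union> T1' \<union> T2'"
    for v F2 T1' T2'
  proof -
    define F1 where "F1 = F - {v}"
    have c1: "card F1 < card F" unfolding F1_def using fin(1) v by (rule card_Diff1_less)
    have c2: "card F2 \<le> card F1" using F2 fin by (simp add: F1_def card_mono)
    have finF: "finite F1" "finite F2" using fin F2 finite_subset by (auto simp: F1_def)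
    have deg1: "card (nbrs F1 T2 x) \<le> D + 3" if "x \<in> F1" for x
    proof -
      have "card (nbrs F1 T2 x) \<le> card (nbrs F T2 x)"
        by (rule card_mono) (use fin in \<open>auto simp: nbrs_def F1_def\<close>)
      also have "\<dots> \<le> D + 3" using deg that by (simp add: F1_def)
      finally show ?thesis .
    qed
    have bud1: "budget D \<mu> F1 T2 \<le> b"
      using budget_subset[OF fin(1) deg _ \<mu>, of F1] unfolding b_def F1_def
      by (smt (verit) Diff_subset divide_nonneg_nonneg of_nat_0_le_iff)
    obtain \<F>1 where 1: "finite \<F>1" "real (card \<F>1) \<le> \<alpha> ^ card F1 * \<beta> powr budget D \<mu> F1 T2"
      "\<forall>(B,T)\<in>\<F>1. B \<subseteq> F1 \<and> finite T \<and> real (card T) \<le> real (card (T1 \<union> T2)) + budget D \<mu> F1 T2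
          \<and> real (card (triads B)) \<le> real (card F1) * K" "covers \<F>1 T2 (F1 \<union> T1 \<union> T2)"
      using less.hyps[OF c1 finF(1) fin(2,3) deg1] by blast
    obtain \<F>2 where 2: "finite \<F>2" "real (card \<F>2) \<le> \<alpha> ^ card F2 * \<beta> powr budget D \<mu> F2 T2'"
      "\<forall>(B,T)\<in>\<F>2. B \<subseteq> F2 \<and> finite T \<and> real (card T) \<le> real (card (T1' \<union> T2')) + budget D \<mu> F2 T2'
          \<and> real (card (triads B)) \<le> real (card F2) * K" "covers \<F>2 T2' (F2 \<union> T1' \<union> T2')"
      using less.hyps[OF le_less_trans[OF c2 c1] finF(2) fin2 deg2] by blast
    define m where "m = card F1"
    have m: "card F = Suc m" using card_Suc_Diff1[OF fin(1) v] by (simp add: m_def F1_def)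
    have "real (card \<F>1) \<le> \<alpha> ^ m * \<beta> powr b"
      using 1(2) bud1 \<alpha>1 \<beta> unfolding m_def
      by (elim order_trans) (intro mult_left_mono powr_mono, auto)
    moreover have "real (card \<F>2) \<le> \<alpha> ^ m * \<beta> powr (b - 1)"
      using 2(2) by (elim order_trans)
        (intro mult_mono powr_mono power_increasing, use bud2 \<alpha>1 \<beta> c2 in \<open>auto simp: m_def\<close>)
    moreover have "\<alpha> ^ m * \<beta> powr b + \<alpha> ^ m * \<beta> powr (b - 1) = \<alpha> ^ m * \<beta> powr b * (1 + 1 / \<beta>)"
      using \<beta> by (simp add: powr_diff algebra_simps)
    moreover have "\<dots> \<le> \<alpha> ^ m * \<beta> powr b * \<alpha>" using \<alpha> \<alpha>1 by (intro mult_left_mono) auto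
    moreover have "real (card (\<F>1 \<union> \<F>2)) \<le> real (card \<F>1) + real (card \<F>2)"
      using card_Un_le[of \<F>1 \<F>2] by linarith
    ultimately have cU: "real (card (\<F>1 \<union> \<F>2)) \<le> \<alpha> ^ card F * \<beta> powr b"
      unfolding m by (simp add: mult_ac)
    have cT: "real (card (T1' \<union> T2')) \<le> real (card (T1 \<union> T2)) + 1"
      unfolding T' using fin by (simp add: card_insert_if)
    have KF: "real (card F1) * K \<le> real (card F) * K" "real (card F2) * K \<le> real (card F) * K"
      using c1 c2 Kpos by (auto intro!: mult_right_mono)
    have props: "\<forall>(B,T)\<in>\<F>1 \<union> \<F>2. B \<subseteq> F \<and> finite T \<and> real (card T) \<le> real (card (T1 \<union> T2)) + b
          \<and> real (card (triads B)) \<le> real (card F) * K"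
    proof -
      have "B \<subseteq> F \<and> finite T \<and> real (card T) \<le> real (card (T1 \<union> T2)) + b
          \<and> real (card (triads B)) \<le> real (card F) * K" if "(B,T) \<in> \<F>1" for B T
      proof -
        have "B \<subseteq> F1" "finite T" "real (card T) \<le> real (card (T1 \<union> T2)) + budget D \<mu> F1 T2"
          "real (card (triads B)) \<le> real (card F1) * K" using that 1(3) by auto
        then show ?thesis using bud1 KF(1) by (auto simp: F1_def)
      qed
      moreover have "B \<subseteq> F \<and> finite T \<and> real (card T) \<le> real (card (T1 \<union> T2)) + b
          \<and> real (card (triads B)) \<le> real (card F) * K" if "(B,T) \<in> \<F>2" for B T
      proof -
        have "B \<subseteq> F2" "finite T" "real (card T) \<le> real (card (T1' \<union> T2')) + budget D \<mu> F2 T2'"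
          "real (card (triads B)) \<le> real (card F2) * K" using that 2(3) by auto
        then show ?thesis using bud2 KF(2) F2 cT by auto
      qed
      ultimately show ?thesis by blast
    qed
    have "covers (\<F>1 \<union> \<F>2) T2 (F \<union> T1 \<union> T2)"
      unfolding covers_def
    proof (intro allI impI)
      fix S assume S: "L_free S" "T2 \<subseteq> S" "S \<subseteq> F \<union> T1 \<union> T2"
      show "\<exists>(B,T)\<in>\<F>1 \<union> \<F>2. S \<subseteq> B \<union> T"
      proof (cases "v \<in> S")
        case True
        then show ?thesis using yes[OF S True] 2(4) S(1) unfolding covers_def by blast
      next
        case False
        then have "S \<subseteq> F1 \<union> T1 \<union> T2" using S(3) by (auto simp: F1_def)
        then show ?thesis using 1(4) S(1,2) unfolding covers_def by blast
      qed
    qed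
    then show ?thesis using cU props 1(1) 2(1) unfolding b_def by (intro exI[of _ "\<F>1 \<union> \<F>2"]) simp
  qed
  consider (high) v where "v \<in> F" "card (nbrs F T2 v) \<ge> D"
    | (new) v where "v \<in> F" "\<And>x. x \<in> F \<Longrightarrow> card (nbrs F T2 x) < D" "real (card (new_pairs F T2 v)) > \<mu>"
    | (stop) "\<And>v. v \<in> F \<Longrightarrow> real (card (new_pairs F T2 v)) \<le> \<mu>"
    by (meson not_le)
  then show ?case
  proof cases
    case high
    define F2 where "F2 = F - {v} - nbrs F T2 v"
    have F2: "F2 \<subseteq> F" by (auto simp: F2_def)
    have "D \<le> card (nbrs F T2 v)" by fact
    also have "\<dots> \<le> card (F - F2)"
      by (rule card_mono) (use fin in \<open>auto simp: F2_def nbrs_def\<close>)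
    finally have "1 \<le> real (card (F - F2)) / real D" using D by simp
    then have bud: "budget D \<mu> F2 T2 \<le> b - 1"
      using budget_subset[OF fin(1) deg F2 \<mu>] unfolding b_def by linarith
    have deg2: "card (nbrs F2 T2 x) \<le> D + 3" if "x \<in> F2" for x
    proof -
      have "card (nbrs F2 T2 x) \<le> card (nbrs F T2 x)"
        by (rule card_mono) (use fin F2 in \<open>auto simp: nbrs_def\<close>)
      also have "\<dots> \<le> D + 3" using deg that F2 by auto
      finally show ?thesis .
    qed
    \<comment> \<open>Here \<open>v\<close> joins \<open>T1\<close>, not \<open>T2\<close>: degrees
      may already be as large as \<open>D + 3\<close>, so adding its edges could break the degree
      bound.\<close>
    show ?thesis
    proof (rule branch[OF high(1), of F2 "insert v T1" T2])
      fix S assume S: "L_free S" "T2 \<subseteq> S" "S \<subseteq> F \<union> T1 \<union> T2" "v \<in> S"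
      have "S \<inter> nbrs F T2 v = {}"
        using S(1,2,4) unfolding L_free_triad nbrs_def by blast
      then show "T2 \<subseteq> S \<and> S \<subseteq> F2 \<union> insert v T1 \<union> T2" using S by (auto simp: F2_def)
    qed (use fin deg2 bud in \<open>auto simp: F2_def\<close>)
  next
    case new
    define F2 where "F2 = F - {v}"
    have F2: "F2 \<subseteq> F" and finF2: "finite F2" using fin by (auto simp: F2_def)
    have "link F2 T2 \<union> new_pairs F T2 v \<subseteq> link F2 (insert v T2)"
      by (auto simp: link_def new_pairs_def F2_def)
    moreover have dis: "link F2 T2 \<inter> new_pairs F T2 v = {}"
      by (auto simp: link_def new_pairs_def F2_def)
    moreover have finN: "finite (new_pairs F T2 v)"
      by (rule finite_subset[of _ "F \<times> F"]) (use fin in \<open>auto simp: new_pairs_def\<close>)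
    ultimately have "card (link F2 T2) + card (new_pairs F T2 v) \<le> card (link F2 (insert v T2))"
      using finF2 by (metis card_Un_disjoint card_mono finite_link)
    then have lk: "real (card (link F2 (insert v T2))) \<ge> real (card (link F2 T2)) + \<mu>"
      using new(3) by linarith
    have "budget D \<mu> F2 (insert v T2) \<le> budget D \<mu> F2 T2 - 1"
    proof -
      have "(2 * real (D + 3) * real (card F2) - real (card (link F2 (insert v T2)))) / \<mu>
         \<le> (2 * real (D + 3) * real (card F2) - real (card (link F2 T2)) - \<mu>) / \<mu>"
        using lk \<mu> by (intro divide_right_mono) auto
      also have "\<dots> = (2 * real (D + 3) * real (card F2) - real (card (link F2 T2))) / \<mu> - 1"
        using \<mu> by (simp add: diff_divide_distrib)
      finally show ?thesis unfolding budget_def by linarith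
    qed
    moreover have "budget D \<mu> F2 T2 \<le> b"
    proof -
      have "0 \<le> real (card (F - F2)) / real D" by simp
      then show ?thesis using budget_subset[OF fin(1) deg F2 \<mu>] unfolding b_def by linarith
    qed
    ultimately have bud: "budget D \<mu> F2 (insert v T2) \<le> b - 1" by linarith
    \<comment> \<open>All degrees are below \<open>D\<close> in this case and \<open>v\<close> adds
      at most 3 neighbours to a vertex, which is where \<open>D + 3\<close> comes from.\<close>
    have deg2: "card (nbrs F2 (insert v T2) x) \<le> D + 3" if "x \<in> F2" for x
    proof -
      have "card (nbrs F2 (insert v T2) x) \<le> card (nbrs F T2 x \<union> {y. triad v x y})"
        by (rule card_mono) (use fin F2 triad_codegree(1) in \<open>auto simp: nbrs_def\<close>)
      also have "\<dots> \<le> card (nbrs F T2 x) + card {y. triad v x y}" by (rule card_Un_le)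
      also have "\<dots> \<le> D + 3" using new(2)[of x] that F2 triad_codegree(2)[of v x] by fastforce
      finally show ?thesis .
    qed
    show ?thesis
      by (rule branch[OF new(1), of F2 T1 "insert v T2"])
         (use fin deg2 bud in \<open>auto simp: F2_def\<close>)
  next
    case stop
    have "1 \<le> \<alpha> ^ card F * \<beta> powr b"
      using mult_mono[OF one_le_power[OF \<alpha>1, of "card F"] ge_one_powr_ge_zero[OF \<beta> b0]] \<alpha>1 by simp
    moreover have "real (card (triads F)) \<le> real (card F) * K"
      unfolding K by (rule card_triads_le[OF fin(1) deg stop])
    moreover have "covers {(F, T1 \<union> T2)} T2 (F \<union> T1 \<union> T2)"
      by (auto simp: covers_def)
    ultimately show ?thesis
      using b0 fin unfolding b_def by (intro exI[of _ "{(F, T1 \<union> T2)}"]) auto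
  qed
qed

text \<open>Run the branching on the whole interval with threshold
  \<open>\<mu> = \<delta> * n / 2\<close>. The initial potential is \<open>n / D\<close> plus a
  constant depending on \<open>D\<close> and \<delta>, so it becomes a small multiple of
  \<open>n\<close> once \<open>D\<close> and then \<open>n\<close> are large.\<close>

lemma containers:
  assumes \<epsilon>: "0 < \<epsilon>" and \<delta>: "0 < \<delta>"
  shows "\<exists>n0. \<forall>n\<ge>n0. \<exists>\<F>. finite \<F> \<and> real (card \<F>) \<le> 2 powr (\<epsilon> * real n) \<and>
     (\<forall>(B,T)\<in>\<F>. B \<subseteq> {1..n} \<and> finite T \<and> real (card T) \<le> \<epsilon> * real n \<and>
         real (card (triads B)) \<le> \<delta> * (real n)\<^sup>2) \<and>
     (\<forall>S. S \<subseteq> {1..n} \<longrightarrow> L_free S \<longrightarrow> (\<exists>(B,T)\<in>\<F>. S \<subseteq> B \<union> T))"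
proof -
  \<comment> \<open>The factor \<open>\<alpha> ^ n\<close> takes half of the exponent
    \<open>\<epsilon> * n\<close>. The choice of \<beta> enforces
    \<open>1 + 1 / \<beta> \<le> \<alpha>\<close>, and \<open>\<beta> powr b\<close> must fit into
    the other half.\<close>
  define \<alpha> :: real where "\<alpha> = 2 powr (\<epsilon> / 2)"
  have \<alpha>: "\<alpha> > 1" using \<epsilon> by (simp add: \<alpha>_def)
  define \<beta> where "\<beta> = max 1 (1 / (\<alpha> - 1))"
  have \<beta>: "\<beta> \<ge> 1" by (simp add: \<beta>_def)
  have "1 / (\<alpha> - 1) \<le> \<beta>" by (simp add: \<beta>_def)
  then have \<alpha>\<beta>: "1 + 1 / \<beta> \<le> \<alpha>" using \<alpha> \<beta> by (simp add: field_simps)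
  \<comment> \<open>\<open>L\<close> dominates both \<open>log 2 \<beta>\<close> and 1, so one bound
    on \<open>L * b\<close> controls the number of leaves and the size of \<open>T\<close>.\<close>
  define L where "L = log 2 \<beta> + 1"
  have L: "L \<ge> 1" using \<beta> by (simp add: L_def)
  obtain D :: nat where D0: "real D > L * 4 / \<epsilon>" using reals_Archimedean2 by blast
  have "L * 4 / \<epsilon> > 0" using L \<epsilon> by simp
  then have D: "D \<ge> 1" using D0 by (cases D) auto
  define c where "c = 4 * real (D + 3) / \<delta>"
  have c: "c \<ge> 0" using \<delta> by (simp add: c_def)
  obtain n0 :: nat where n0: "real n0 > max (L * c * 4 / \<epsilon>) (max ((15 + 3 * real D) * 2 / \<delta>) 1)"
    using reals_Archimedean2 by blast
  show ?thesis
  proof (intro exI[of _ n0] allI impI)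
    fix n assume "n0 \<le> n"
    then have n: "real n > L * c * 4 / \<epsilon>" "real n > (15 + 3 * real D) * 2 / \<delta>" "real n > 1"
      using n0 by (auto simp: less_le_trans)
    define \<mu> where "\<mu> = \<delta> * real n / 2"
    have \<mu>: "\<mu> > 0" using \<delta> n by (simp add: \<mu>_def)
    define b where "b = budget D \<mu> {1..n} {}"
    have b: "b = real n / real D + c"
    proof -
      have "link {1..n} {} = {}" by (auto simp: link_def)
      then show ?thesis using n \<delta> by (simp add: b_def budget_def \<mu>_def c_def field_simps)
    qed
    have "L * (real n / real D) \<le> \<epsilon> / 4 * real n"
    proof -
      have "L * 4 < real D * \<epsilon>" using D0 \<epsilon> by (simp add: field_simps)
      then have "L * 4 * real n \<le> real D * \<epsilon> * real n" by (intro mult_right_mono) auto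
      then show ?thesis using D by (simp add: field_simps)
    qed
    moreover have "L * c \<le> \<epsilon> / 4 * real n" using n(1) \<epsilon> by (simp add: field_simps)
    ultimately have Lb: "L * b \<le> \<epsilon> / 2 * real n" unfolding b distrib_left by linarith
    have b0: "b \<ge> 0" using c by (simp add: b)
    have bn: "b \<le> \<epsilon> * real n"
    proof -
      have "1 * b \<le> L * b" using L b0 by (intro mult_right_mono) auto
      also have "\<dots> \<le> \<epsilon> / 2 * real n" by (rule Lb)
      also have "\<dots> \<le> \<epsilon> * real n" using \<epsilon> by (intro mult_right_mono) auto
      finally show ?thesis by simp
    qed
    define K where "K = \<mu> + 6 + 3 * real (D + 3)"
    have K: "real n * K \<le> \<delta> * (real n)\<^sup>2"
    proof -
      have "K \<le> \<delta> * real n" using n(2) \<delta> by (simp add: K_def \<mu>_def field_simps)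
      then have "real n * K \<le> real n * (\<delta> * real n)" by (intro mult_left_mono) auto
      then show ?thesis by (simp add: power2_eq_square mult_ac)
    qed
    obtain \<F> where F: "finite \<F>" "real (card \<F>) \<le> \<alpha> ^ card {1..n} * \<beta> powr b"
      "\<forall>(B,T)\<in>\<F>. B \<subseteq> {1..n} \<and> finite T \<and> real (card T) \<le> real (card ({} \<union> {}::nat set)) + b
          \<and> real (card (triads B)) \<le> real (card {1..n}) * K"
      "covers \<F> {} ({1..n} \<union> {} \<union> {})"
      using branching[OF D \<mu> \<beta> \<alpha>\<beta> K_def, of "{1..n}" "{}" "{}"] unfolding b_def
      by (auto simp: nbrs_def)
    have "\<alpha> ^ card {1..n} * \<beta> powr b = 2 powr (\<epsilon> / 2 * real n + log 2 \<beta> * b)"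
    proof -
      have "\<alpha> ^ n = 2 powr (\<epsilon> / 2 * real n)" by (simp add: \<alpha>_def powr_powr flip: powr_realpow)
      moreover have "\<beta> powr b = 2 powr (log 2 \<beta> * b)" using \<beta> by (simp add: powr_powr[symmetric])
      ultimately show ?thesis by (simp add: powr_add)
    qed
    also have "\<dots> \<le> 2 powr (\<epsilon> * real n)"
    proof (rule powr_mono)
      have "log 2 \<beta> * b \<le> L * b" using b0 by (intro mult_right_mono) (auto simp: L_def)
      then show "\<epsilon> / 2 * real n + log 2 \<beta> * b \<le> \<epsilon> * real n" using Lb by linarith
    qed simp
    finally have "real (card \<F>) \<le> 2 powr (\<epsilon> * real n)" using F(2) by linarith
    moreover have "\<forall>(B,T)\<in>\<F>. B \<subseteq> {1..n} \<and> finite T \<and> real (card T) \<le> \<epsilon> * real n \<and>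
         real (card (triads B)) \<le> \<delta> * (real n)\<^sup>2"
      using F(3) bn K by fastforce
    moreover have "\<forall>S. S \<subseteq> {1..n} \<longrightarrow> L_free S \<longrightarrow> (\<exists>(B,T)\<in>\<F>. S \<subseteq> B \<union> T)"
      using F(4) by (auto simp: covers_def)
    ultimately show "\<exists>\<F>. finite \<F> \<and> real (card \<F>) \<le> 2 powr (\<epsilon> * real n) \<and>
     (\<forall>(B,T)\<in>\<F>. B \<subseteq> {1..n} \<and> finite T \<and> real (card T) \<le> \<epsilon> * real n \<and>
         real (card (triads B)) \<le> \<delta> * (real n)\<^sup>2) \<and>
     (\<forall>S. S \<subseteq> {1..n} \<longrightarrow> L_free S \<longrightarrow> (\<exists>(B,T)\<in>\<F>. S \<subseteq> B \<union> T))"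
      using F(1) by blast
  qed
qed

section \<open>Arithmetic removal\<close>

text \<open>Discard the elements that have at least \<open>n / 3\<close> of their edges in the
  removed set. A solution among the rest would span \<open>n\<close> edge-disjoint triangles, all
  hit by the removed set, although each of its three elements accounts for fewer than
  \<open>n / 3\<close> hits.\<close>

lemma arithmetic_removal:
  assumes \<epsilon>: "0 < \<epsilon>"
  shows "\<exists>\<delta>>0. \<forall>n F. F \<subseteq> {1..n} \<longrightarrow> real (card (triads F)) \<le> \<delta> * (real n)\<^sup>2 \<longrightarrow>
     (\<exists>C\<subseteq>F. real (card C) \<le> \<epsilon> * real n \<and> L_free (F - C))"
proof -
  \<comment> \<open>\<open>324 = 36 * 9\<close>: the graph has \<open>6 * n\<close> vertices, and
    the remaining \<open>\<epsilon> / 9 * n\<^sup>2\<close> removed edges, divided by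
    \<open>n / 3\<close>, leave \<open>\<epsilon> / 3 * n\<close> elements for each of the three
    edge types.\<close>
  have "0 < \<epsilon> / 324" using \<epsilon> by simp
  from triangle_removal[OF this, where 'a = "nat \<times> nat"]
  obtain \<delta> where \<delta>: "\<delta> > 0" and rem: "\<And>(V::(nat\<times>nat) set) E. finite V \<Longrightarrow> E \<subseteq> V \<times> V \<Longrightarrow>
     real (card {(x,y,z). (x,y) \<in> E \<and> (y,z) \<in> E \<and> (x,z) \<in> E}) \<le> \<delta> * real (card V)^3 \<Longrightarrow>
     (\<exists>R\<subseteq>V \<times> V. real (card R) \<le> (\<epsilon> / 324) * (real (card V))\<^sup>2 \<and>
        (\<forall>x y z. (x,y) \<in> E \<longrightarrow> (y,z) \<in> E \<longrightarrow> (x,z) \<in> E \<longrightarrow> (x,y) \<in> R \<or> (y,z) \<in> R \<or> (x,z) \<in> R))"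
    by (elim exE conjE) blast
  show ?thesis
  proof (intro exI[of _ \<delta>] conjI allI impI \<delta>)
    fix n F assume F: "F \<subseteq> {1..n}" and few: "real (card (triads F)) \<le> \<delta> * (real n)\<^sup>2"
    have finF: "finite F" using F finite_subset by blast
    \<comment> \<open>Positions run up to \<open>2 * n\<close> so that for \<open>x < n\<close> and
      \<open>c \<le> n\<close> the vertices at \<open>x + 2 * a\<close> and \<open>x + c\<close>
      exist.\<close>
    define V :: "(nat \<times> nat) set" where "V = {..<3} \<times> {..<2*n}"
    have finV: "finite V" and cV: "card V = 6 * n" by (auto simp: V_def card_cartesian_product)
    \<comment> \<open>A triple \<open>2 a + 2 b = c\<close> gives a triangle \<open>(0, x)\<close>, \<open>(1, x + 2 a)\<close>, \<open>(2, x + c)\<close> for each \<open>x\<close>;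
      for a fixed triple these triangles are edge-disjoint.\<close>
    define e1 where "e1 a x = ((0::nat, x), (1::nat, x + 2 * a))" for a x :: nat
    define e2 where "e2 a x = ((1::nat, x), (2::nat, x + 2 * a))" for a x :: nat
    define e3 where "e3 a x = ((0::nat, x), (2::nat, x + a))" for a x :: nat
    define E where "E = {w \<in> V \<times> V. \<exists>a\<in>F. \<exists>x. w = e1 a x \<or> w = e2 a x \<or> w = e3 a x}"
    have EV: "E \<subseteq> V \<times> V" by (auto simp: E_def)
    define Tri where "Tri = {(x,y,z). (x,y) \<in> E \<and> (y,z) \<in> E \<and> (x,z) \<in> E}"
    have "Tri \<subseteq> (\<lambda>((a,b,c),x). ((0,x),(1,x+2*a),(2,x+c))) ` (triads F \<times> {..<2*n})"
    proof
      fix t assume "t \<in> Tri"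
      then obtain u v w where t: "t = (u,v,w)" "(u,v) \<in> E" "(v,w) \<in> E" "(u,w) \<in> E"
        by (auto simp: Tri_def)
      obtain a x where a: "a \<in> F" "u = (0,x)" "v = (1,x+2*a)" "x < 2 * n"
      proof -
        have "fst v = 0 \<or> fst v = 1"
          using t(3) by (auto simp: E_def e1_def e2_def e3_def)
        have "fst v \<noteq> 0" using t(2) by (auto simp: E_def e1_def e2_def e3_def)
        then have "fst v = 1" using \<open>fst v = 0 \<or> fst v = 1\<close> by simp
        then have "\<exists>a\<in>F. \<exists>x. u = (0,x) \<and> v = (1,x+2*a) \<and> x < 2 * n"
          using t(2) by (auto simp: E_def e1_def e2_def e3_def V_def)
        then show thesis using that by blast
      qed
      obtain b where b: "b \<in> F" "w = (2, x + 2 * a + 2 * b)"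
        using t(3) a(3) by (auto simp: E_def e1_def e2_def e3_def)
      obtain c where c: "c \<in> F" "w = (2, x + c)"
        using t(4) a(2) b(2) by (auto simp: E_def e1_def e2_def e3_def)
      have "c = 2 * a + 2 * b" using b(2) c(2) by simp
      then have "((a,b,c),x) \<in> triads F \<times> {..<2*n}"
        using a b(1) c(1) by (auto simp: triads_def triad_def)
      then show "t \<in> (\<lambda>((a,b,c),x). ((0,x),(1,x+2*a),(2,x+c))) ` (triads F \<times> {..<2*n})"
        using t(1) a(2,3) c(2) by (intro image_eqI[where x = "((a,b,c),x)"]) auto
    qed
    moreover have fint: "finite (triads F)"
      by (rule finite_subset[of _ "F \<times> F \<times> F"]) (use finF in \<open>auto simp: triads_def\<close>)
    ultimately have "card Tri \<le> card (triads F \<times> {..<2*n})"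
      by (intro surj_card_le) auto
    then have "real (card Tri) \<le> real (card (triads F \<times> {..<2*n}))"
      by (rule of_nat_mono)
    also have "\<dots> = real (card (triads F)) * (2 * real n)"
      by (simp add: card_cartesian_product)
    also have "\<dots> \<le> \<delta> * (real n)\<^sup>2 * (2 * real n)"
      using few by (intro mult_right_mono) auto
    also have "\<dots> \<le> \<delta> * (real (card V))^3"
      using \<delta> by (simp add: cV eval_nat_numeral mult_ac)
    finally obtain R where R: "R \<subseteq> V \<times> V" "real (card R) \<le> (\<epsilon> / 324) * (real (card V))\<^sup>2"
      "\<And>x y z. (x,y) \<in> E \<Longrightarrow> (y,z) \<in> E \<Longrightarrow> (x,z) \<in> E \<Longrightarrow> (x,y) \<in> R \<or> (y,z) \<in> R \<or> (x,z) \<in> R"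
      using rem[OF finV EV] unfolding Tri_def by blast
    have finR: "finite R" using R(1) finV finite_subset by blast
    define C where "C e = {a\<in>F. real n / 3 \<le> card {x. x < 2 * n \<and> e a x \<in> R}}" for e :: "nat \<Rightarrow> nat \<Rightarrow> (nat \<times> nat) \<times> (nat \<times> nat)"
    have cC: "real (card (C e)) \<le> \<epsilon> / 3 * real n" if inj: "inj (\<lambda>(a,x). e a x)" for e
    proof (cases "n = 0")
      case True
      then show ?thesis using F by (simp add: C_def)
    next
      case False
      have finC: "finite (C e)" using finF by (simp add: C_def)
      have "real (card (C e)) * (real n / 3) = (\<Sum>a\<in>C e. real n / 3)" by simp
      also have "\<dots> \<le> (\<Sum>a\<in>C e. real (card {x. x < 2 * n \<and> e a x \<in> R}))"
        by (rule sum_mono) (auto simp: C_def)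
      also have "\<dots> = real (card (SIGMA a:C e. {x. x < 2 * n \<and> e a x \<in> R}))"
        using finC by simp
      also have "\<dots> \<le> real (card R)"
        by (intro of_nat_mono card_inj_on_le[where f = "\<lambda>(a,x). e a x"] finR)
           (auto intro: inj_on_subset[OF inj])
      also have "\<dots> \<le> (\<epsilon> / 9 * real n) * real n"
        using R(2) by (simp add: cV power2_eq_square)
      finally show ?thesis using False by (simp add: field_simps)
    qed
    have inj: "inj (\<lambda>(a,x). e1 a x)" "inj (\<lambda>(a,x). e2 a x)" "inj (\<lambda>(a,x). e3 a x)"
      by (auto simp: inj_on_def e1_def e2_def e3_def)
    define D where "D = C e1 \<union> C e2 \<union> C e3"
    have "card D \<le> card (C e1) + card (C e2) + card (C e3)"
      unfolding D_def by (meson add_le_mono1 card_Un_le le_trans)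
    then have cD: "real (card D) \<le> \<epsilon> * real n"
      using cC[OF inj(1)] cC[OF inj(2)] cC[OF inj(3)] by linarith
    have "L_free (F - D)"
      unfolding L_free_def
    proof (intro notI, elim bexE)
      fix a b c assume abc: "a \<in> F - D" "b \<in> F - D" "c \<in> F - D" "2 * a + 2 * b = c"
      have cn: "c \<le> n" using abc F by auto
      define X1 where "X1 = {x. x < n \<and> e1 a x \<in> R}"
      define X2 where "X2 = {x. x < n \<and> e2 b (x + 2 * a) \<in> R}"
      define X3 where "X3 = {x. x < n \<and> e3 c x \<in> R}"
      have "card X1 \<le> card {x. x < 2 * n \<and> e1 a x \<in> R}"
        by (rule card_mono) (auto simp: X1_def)
      then have 1: "real (card X1) < real n / 3" using abc(1) by (auto simp: D_def C_def)
      have "card X2 \<le> card {x. x < 2 * n \<and> e2 b x \<in> R}"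
        by (rule card_inj_on_le[where f = "\<lambda>x. x + 2 * a"]) (use cn abc(4) in \<open>auto simp: X2_def\<close>)
      then have 2: "real (card X2) < real n / 3" using abc(2) by (auto simp: D_def C_def)
      have "card X3 \<le> card {x. x < 2 * n \<and> e3 c x \<in> R}"
        by (rule card_mono) (auto simp: X3_def)
      then have 3: "real (card X3) < real n / 3" using abc(3) by (auto simp: D_def C_def)
      have "{..<n} \<subseteq> X1 \<union> X2 \<union> X3"
      proof
        fix x assume x: "x \<in> {..<n}"
        have "e1 a x \<in> E" "e2 b (x + 2 * a) \<in> E" "e3 c x \<in> E"
          using abc x cn by (auto simp: E_def e1_def e2_def e3_def V_def)
        then have "e1 a x \<in> R \<or> e2 b (x + 2 * a) \<in> R \<or> e3 c x \<in> R"
          using R(3)[of "(0,x)" "(1,x+2*a)" "(2,x+c)"] abc(4)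
          by (simp add: e1_def e2_def e3_def add.assoc)
        then show "x \<in> X1 \<union> X2 \<union> X3" using x by (auto simp: X1_def X2_def X3_def)
      qed
      then have "n \<le> card (X1 \<union> X2 \<union> X3)"
        using card_mono[of "X1 \<union> X2 \<union> X3" "{..<n}"] by (simp add: X1_def X2_def X3_def)
      also have "\<dots> \<le> card X1 + card X2 + card X3"
        by (meson add_le_mono1 card_Un_le le_trans)
      finally show False using 1 2 3 by linarith
    qed
    moreover have "D \<subseteq> F" by (auto simp: D_def C_def)
    ultimately show "\<exists>C\<subseteq>F. real (card C) \<le> \<epsilon> * real n \<and> L_free (F - C)" using cD by blast
  qed
qed

section \<open>Maximal independent sets\<close>

definition max_indep :: "('a \<Rightarrow> 'a \<Rightarrow> bool) \<Rightarrow> 'a set \<Rightarrow> 'a set \<Rightarrow> bool" where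
  "max_indep E V S \<longleftrightarrow> S \<subseteq> V \<and> (\<forall>u\<in>S. \<forall>v\<in>S. \<not> E u v) \<and> (\<forall>v\<in>V - S. \<exists>u\<in>S. E u v)"

text \<open>Integer form of \<open>k \<le> 3 powr (k / 3)\<close>, the estimate that closes the
  Moon--Moser induction.\<close>

lemma cube_le_3_power: "k ^ 3 \<le> (3::nat) ^ k"
proof (cases "k \<le> 2")
  case True
  then have "k = 0 \<or> k = 1 \<or> k = 2" by auto
  then show ?thesis by auto
next
  case False
  then have "3 \<le> k" by simp
  then show ?thesis
  proof (induction k rule: dec_induct)
    case (step k)
    have "(k + 1) ^ 3 = k^3 + 3 * k^2 + 3 * k + 1" by (simp add: eval_nat_numeral algebra_simps)
    moreover have "3 * k\<^sup>2 \<le> k ^ 3"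
      unfolding power3_eq_cube power2_eq_square mult.assoc using step by (intro mult_le_mono1) auto
    moreover have "3 * k + 1 \<le> k ^ 3"
    proof -
      have "3 * 3 * k \<le> k * k * k" using step by (intro mult_le_mono) auto
      then show ?thesis using step by (simp add: eval_nat_numeral)
    qed
    ultimately show ?case using step.IH by simp
  qed simp
qed

text \<open>A maximal independent set meets the closed neighbourhood of every vertex. Take
  \<open>v\<close> with the smallest one, of size \<open>k\<close>. The sets containing a given
  \<open>u \<in> N v\<close> arise from maximal independent sets of \<open>V - N u\<close>, which
  has at most \<open>card V - k\<close> vertices.\<close>

lemma moon_moser:
  fixes E :: "'a \<Rightarrow> 'a \<Rightarrow> bool"
  assumes "finite V" and sym: "\<And>u v. E u v \<Longrightarrow> E v u" and irrefl: "\<And>u. \<not> E u u"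
  shows "real (card {S. max_indep E V S}) \<le> 3 powr (real (card V) / 3)"
  using assms(1)
proof (induction "card V" arbitrary: V rule: less_induct)
  case less
  show ?case
  proof (cases "V = {}")
    case True
    then have "{S. max_indep E V S} = {{}}" by (auto simp: max_indep_def)
    then show ?thesis using True by simp
  next
    case False
    define N where "N v = insert v {u\<in>V. E v u}" for v
    obtain v where v: "v \<in> V" "\<And>u. u \<in> V \<Longrightarrow> card (N v) \<le> card (N u)"
      using ex_min_if_finite[of "(\<lambda>u. card (N u)) ` V"] less.prems False by fastforce
    have NV: "N u \<subseteq> V" if "u \<in> V" for u using that by (auto simp: N_def)
    have finN: "finite (N u)" for u using less.prems by (auto simp: N_def)
    define k where "k = card (N v)"
    have kpos: "k > 0" using finN[of v] by (auto simp: k_def card_gt_0_iff N_def)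
    define M where "M W = {S. max_indep E W S}" for W
    have finM: "finite (M W)" if "finite W" for W
      by (rule finite_subset[of _ "Pow W"]) (use that in \<open>auto simp: M_def max_indep_def\<close>)
    have sub: "M V \<subseteq> (\<Union>u\<in>N v. insert u ` M (V - N u))"
    proof
      fix S assume S: "S \<in> M V"
      then have "\<exists>u\<in>N v. u \<in> S"
        using v(1) sym unfolding M_def max_indep_def N_def by blast
      then obtain u where u: "u \<in> N v" "u \<in> S" by auto
      have "S - {u} \<in> M (V - N u)"
        using S u sym irrefl unfolding M_def max_indep_def N_def by blast
      moreover have "S = insert u (S - {u})" using u by auto
      ultimately show "S \<in> (\<Union>u\<in>N v. insert u ` M (V - N u))" using u by blast
    qed
    have each: "real (card (M (V - N u))) \<le> 3 powr ((real (card V) - real k) / 3)" if "u \<in> N v" for u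
    proof -
      have uV: "u \<in> V" using that NV[OF v(1)] by auto
      have c: "card (V - N u) = card V - card (N u)"
        using NV[OF uV] finN by (simp add: card_Diff_subset)
      have le: "card (N u) \<le> card V" using NV[OF uV] less.prems by (simp add: card_mono)
      have kk: "k \<le> card (N u)" using v(2)[OF uV] by (simp add: k_def)
      have "card (V - N u) < card V" using c kk kpos le by linarith
      then have "real (card (M (V - N u))) \<le> 3 powr (real (card (V - N u)) / 3)"
        using less.hyps less.prems unfolding M_def by simp
      also have "\<dots> \<le> 3 powr ((real (card V) - real k) / 3)"
        using c kk le by (intro powr_mono) (auto simp: of_nat_diff)
      finally show ?thesis .
    qed
    have "card (M V) \<le> card (\<Union>u\<in>N v. insert u ` M (V - N u))"
      by (rule card_mono[OF _ sub]) (use finN finM less.prems in auto)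
    also have "\<dots> \<le> (\<Sum>u\<in>N v. card (insert u ` M (V - N u)))"
      by (rule card_UN_le[OF finN])
    also have "\<dots> \<le> (\<Sum>u\<in>N v. card (M (V - N u)))"
      by (intro sum_mono card_image_le finM) (use less.prems in auto)
    finally have "real (card (M V)) \<le> (\<Sum>u\<in>N v. real (card (M (V - N u))))"
      by (metis of_nat_mono of_nat_sum)
    also have "\<dots> \<le> (\<Sum>u\<in>N v. 3 powr ((real (card V) - real k) / 3))"
      by (rule sum_mono[OF each])
    also have "\<dots> = real k * 3 powr ((real (card V) - real k) / 3)" by (simp add: k_def)
    also have "\<dots> \<le> 3 powr (real k / 3) * 3 powr ((real (card V) - real k) / 3)"
    proof (rule mult_right_mono)
      have "real k ^ 3 \<le> 3 ^ k" using cube_le_3_power[of k] by (metis of_nat_mono of_nat_numeral of_nat_power)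
      also have "\<dots> = (3 powr (real k / 3)) ^ 3"
        by (simp add: powr_realpow[symmetric] powr_powr)
      finally show "real k \<le> 3 powr (real k / 3)"
        by (simp add: power_mono_iff)
    qed simp
    also have "\<dots> = 3 powr (real (card V) / 3)"
      by (simp add: powr_add[symmetric] field_simps)
    finally show ?thesis by (simp add: M_def)
  qed
qed

section \<open>Counting maximal sets inside a container\<close>

text \<open>The variables of the equation may coincide, so the blocking triad can use
  \<open>v\<close> more than once; hence \<open>insert v S\<close>.\<close>

lemma maximal_blocked:
  assumes S: "maximal_L_free n S" and v: "v \<in> {1..n}" "v \<notin> S"
  shows "\<exists>p\<in>insert v S. \<exists>q\<in>insert v S. triad v p q"
proof -
  have "L_free S" "S \<subseteq> {1..n}" using S by (auto simp: maximal_L_free_def)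
  moreover have "\<not> L_free (insert v S)"
  proof
    assume "L_free (insert v S)"
    moreover have "S \<subset> insert v S" "insert v S \<subseteq> {1..n}" using v \<open>S \<subseteq> {1..n}\<close> by auto
    ultimately show False using S unfolding maximal_L_free_def by blast
  qed
  ultimately obtain a b c where "a \<in> insert v S" "b \<in> insert v S" "c \<in> insert v S" "triad a b c"
    "a = v \<or> b = v \<or> c = v"
    unfolding L_free_triad by blast
  then show ?thesis using triad_swap by metis
qed

definition large_odds :: "nat \<Rightarrow> nat set" where
  "large_odds n = {x\<in>{1..n}. odd x \<and> n < 2 * x}"

text \<open>An odd number is not of the form \<open>2 * a + 2 * b\<close>, and a number above
  \<open>n / 2\<close> is too large for the summand position.\<close>

lemma large_odds_no_triad:
  assumes "x \<in> large_odds n" "y \<in> {1..n}" "z \<in> {1..n}"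
  shows "\<not> triad x y z"
  using assms by (auto simp: large_odds_def triad_def)

lemma large_odds_subset_maximal:
  assumes "maximal_L_free n S" shows "large_odds n \<subseteq> S"
proof
  fix x assume x: "x \<in> large_odds n"
  then have xn: "x \<in> {1..n}" by (auto simp: large_odds_def)
  have "S \<subseteq> {1..n}" using assms by (auto simp: maximal_L_free_def)
  then show "x \<in> S"
    using maximal_blocked[OF assms xn] large_odds_no_triad[OF x] xn by blast
qed

lemma finite_maximal: "finite {S. maximal_L_free n S \<and> P S}"
  by (rule finite_subset[of _ "Pow {1..n}"]) (auto simp: maximal_L_free_def)

text \<open>The trace on \<open>K\<close> determines the set: if \<open>x\<close> lies in
  \<open>S1\<close> but not in \<open>S2\<close>, it is blocked by a triad whose other two entries
  lie in \<open>S2 \<inter> K = S1 \<inter> K\<close>, contradicting that \<open>S1\<close> is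
  free.\<close>

lemma card_maximal_determined:
  assumes K: "finite K" and U: "U \<subseteq> {1..n}"
    and det: "\<And>x y z. x \<in> U - K \<Longrightarrow> y \<in> U \<Longrightarrow> z \<in> U \<Longrightarrow> triad x y z \<Longrightarrow> y \<in> K \<and> z \<in> K"
  shows "card {S. maximal_L_free n S \<and> S \<subseteq> U} \<le> 2 ^ card K"
proof -
  have sub: "S1 \<subseteq> S2" if S: "maximal_L_free n S1" "S1 \<subseteq> U" "maximal_L_free n S2" "S2 \<subseteq> U" "S1 \<inter> K = S2 \<inter> K" for S1 S2
  proof
    fix x assume x: "x \<in> S1"
    show "x \<in> S2"
    proof (rule ccontr)
      assume nx: "x \<notin> S2"
      then have xU: "x \<in> U - K" using x S by auto
      obtain p q where pq: "p \<in> insert x S2" "q \<in> insert x S2" "triad x p q"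
        using maximal_blocked[OF S(3) _ nx] xU U by blast
      then have "p \<in> K \<and> q \<in> K" using det[OF xU] xU S(4) by blast
      then have "p \<in> S1" "q \<in> S1" using pq xU S(5) by auto
      then show False using x pq(3) S(1) unfolding maximal_L_free_def L_free_triad by blast
    qed
  qed
  have "inj_on (\<lambda>S. S \<inter> K) {S. maximal_L_free n S \<and> S \<subseteq> U}"
    by (rule inj_onI) (use sub in blast)
  then have "card {S. maximal_L_free n S \<and> S \<subseteq> U} \<le> card (Pow K)"
    by (rule card_inj_on_le) (use K in auto)
  then show ?thesis using K by (simp add: card_Pow)
qed

text \<open>Fix the trace \<open>A\<close> on \<open>C\<close>. A triad blocking a vertex of
  \<open>W\<close> cannot have its other entries both in \<open>A\<close>, by the choice of
  \<open>W\<close>, nor both in \<open>B\<close>, which is free; so it is an edge of the link graph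
  of \<open>A\<close>. Thus the rest of \<open>S\<close> is a maximal independent set and
  Moon--Moser applies.\<close>

lemma card_maximal_link_graph:
  assumes B: "B \<subseteq> {1..n}" "L_free B" and C: "finite C"
  shows "real (card {S. maximal_L_free n S \<and> S \<subseteq> B \<union> C}) \<le>
     2 ^ card C * 3 powr (real (card (B - large_odds n)) / 3)"
proof -
  define Fam where "Fam A = {S. maximal_L_free n S \<and> S \<subseteq> B \<union> C \<and> S \<inter> C = A}" for A
  have finB: "finite B" using B finite_subset by blast
  have fib: "real (card (Fam A)) \<le> 3 powr (real (card (B - large_odds n)) / 3)" if "A \<subseteq> C" for A
  proof -
    \<comment> \<open>Left out are the loops of the link graph and the elements blocked by
      \<open>A\<close> alone; neither can occur in a free set containing \<open>A\<close>.\<close>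
    define W where "W = {x \<in> B - large_odds n - C. \<not> (\<exists>a\<in>A. triad a x x) \<and> \<not> (\<exists>a\<in>A. \<exists>a'\<in>A. triad a a' x)}"
    define E where "E x y \<longleftrightarrow> x \<noteq> y \<and> (\<exists>a\<in>A. triad a x y)" for x y
    have finW: "finite W" using finB by (simp add: W_def)
    have dec: "S = A \<union> (S \<inter> W) \<union> large_odds n" if S: "S \<in> Fam A" for S
    proof -
      have "L_free S" "A \<subseteq> S" "S \<subseteq> B \<union> C" "S \<inter> C = A" "large_odds n \<subseteq> S"
        using S large_odds_subset_maximal by (auto simp: Fam_def maximal_L_free_def)
      then show ?thesis unfolding W_def L_free_triad by blast
    qed
    have mis: "max_indep E W (S \<inter> W)" if S: "S \<in> Fam A" for S
    proof -
      have max: "maximal_L_free n S" using S by (simp add: Fam_def)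
      have S': "L_free S" "A \<subseteq> S" "S \<subseteq> {1..n}" "large_odds n \<subseteq> S"
        using S large_odds_subset_maximal by (auto simp: Fam_def maximal_L_free_def)
      have SA: "x \<in> B \<and> (x \<in> W \<or> x \<in> large_odds n)" if "x \<in> S" "x \<notin> A" for x
        using dec[OF S] that S unfolding Fam_def by blast
      have nbr: "\<exists>u\<in>S \<inter> W. E u v" if v: "v \<in> W - S \<inter> W" for v
      proof -
        have vS: "v \<notin> S" and vW: "v \<in> W" and vB: "v \<in> B" using v by (auto simp: W_def)
        have vn: "v \<in> {1..n}" using vB B by auto
        have odd_out: "x \<in> W" if "x \<in> S" "x \<notin> A" "triad v x y" "y \<in> insert v S" for x y
        proof -
          have "triad x v y" using that triad_swap by blast
          then have "x \<notin> large_odds n" using large_odds_no_triad that vn S'(3) by blast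
          then show ?thesis using SA that by blast
        qed
        obtain p q where pq: "p \<in> insert v S" "q \<in> insert v S" "triad v p q"
          using maximal_blocked[OF max vn vS] by blast
        have pq': "triad v q p" "triad p v q" "triad q v p" "triad p q v" "triad q p v"
          using pq(3) triad_swap by blast+
        have free: "x \<notin> B \<or> y \<notin> B" if "triad v x y" for x y
          using B(2) that vB unfolding L_free_triad by blast
        have nA: "\<not> (p \<in> A \<and> q \<in> A)" using vW pq' by (auto simp: W_def)
        have nA1: "\<not> (p \<in> A \<and> q = v)" "\<not> (q \<in> A \<and> p = v)" using vW pq' pq(3) by (auto simp: W_def)
        have BB: "x \<in> A \<or> x \<in> B" if "x \<in> insert v S" for x using that SA vB by blast
        have "p \<in> A \<and> q \<in> S \<and> q \<notin> A \<or> q \<in> A \<and> p \<in> S \<and> p \<notin> A"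
          using nA nA1 BB[OF pq(1)] BB[OF pq(2)] free[OF pq(3)] pq(1,2) by blast
        then show ?thesis
        proof
          assume a: "p \<in> A \<and> q \<in> S \<and> q \<notin> A"
          then have "q \<in> W" using odd_out[of q p] pq pq' by simp
          then show ?thesis using a pq' vS unfolding E_def by (intro bexI[of _ q]) auto
        next
          assume a: "q \<in> A \<and> p \<in> S \<and> p \<notin> A"
          then have "p \<in> W" using odd_out[of p q] pq pq' by simp
          then show ?thesis using a pq' vS unfolding E_def by (intro bexI[of _ p]) auto
        qed
      qed
      have "\<not> E u v" if "u \<in> S" "v \<in> S" for u v
        using S'(1,2) that unfolding E_def L_free_triad by blast
      then show ?thesis using nbr unfolding max_indep_def by blast
    qed
    have "inj_on (\<lambda>S. S \<inter> W) (Fam A)"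
      by (rule inj_onI) (metis dec)
    moreover have fin: "finite {S. max_indep E W S}"
      by (rule finite_subset[of _ "Pow W"]) (use finW in \<open>auto simp: max_indep_def\<close>)
    ultimately have "card (Fam A) \<le> card {S. max_indep E W S}"
      using mis by (intro card_inj_on_le[where f = "\<lambda>S. S \<inter> W"]) auto
    then have "real (card (Fam A)) \<le> real (card {S. max_indep E W S})" by simp
    also have "\<dots> \<le> 3 powr (real (card W) / 3)"
    proof (rule moon_moser[OF finW])
      show "E u v \<Longrightarrow> E v u" for u v using triad_swap(2) unfolding E_def by blast
    qed (simp add: E_def)
    also have "\<dots> \<le> 3 powr (real (card (B - large_odds n)) / 3)"
      by (intro powr_mono divide_right_mono of_nat_mono card_mono) (use finB in \<open>auto simp: W_def\<close>)
    finally show ?thesis .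
  qed
  have "{S. maximal_L_free n S \<and> S \<subseteq> B \<union> C} = (\<Union>A\<in>Pow C. Fam A)"
    by (auto simp: Fam_def)
  then have "card {S. maximal_L_free n S \<and> S \<subseteq> B \<union> C} \<le> (\<Sum>A\<in>Pow C. card (Fam A))"
    using card_UN_le[of "Pow C" Fam] C by simp
  then have "real (card {S. maximal_L_free n S \<and> S \<subseteq> B \<union> C}) \<le> real (\<Sum>A\<in>Pow C. card (Fam A))"
    by (rule of_nat_mono)
  also have "\<dots> = (\<Sum>A\<in>Pow C. real (card (Fam A)))" by simp
  also have "\<dots> \<le> (\<Sum>A\<in>Pow C. 3 powr (real (card (B - large_odds n)) / 3))"
    by (rule sum_mono) (use fib in auto)
  also have "\<dots> = 2 ^ card C * 3 powr (real (card (B - large_odds n)) / 3)"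
    using C by (simp add: card_Pow)
  finally show ?thesis .
qed

section \<open>Extension to maximal sets and the lower bound\<close>

lemma L_free_extend:
  assumes "S \<subseteq> {1..n}" "L_free S"
  shows "\<exists>M. S \<subseteq> M \<and> maximal_L_free n M"
proof -
  let ?X = "{T. T \<subseteq> {1..n} \<and> L_free T}"
  have "finite ?X" by (rule finite_subset[of _ "Pow {1..n}"]) auto
  then obtain M where M: "M \<in> ?X" "S \<subseteq> M" "\<forall>T\<in>?X. M \<subseteq> T \<longrightarrow> M = T"
    using finite_has_maximal2[of ?X S] assms by auto
  have "maximal_L_free n M"
    unfolding maximal_L_free_def using M by blast
  then show ?thesis using M(2) by blast
qed

lemma f_max_pos: "f_max n \<ge> 1"
proof -
  obtain M where "maximal_L_free n M" using L_free_extend[of "{}" n] by (auto simp: L_free_def)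
  then have "{S. maximal_L_free n S} \<noteq> {}" by blast
  moreover have "finite {S. maximal_L_free n S}" using finite_maximal[of n "\<lambda>_. True"] by simp
  ultimately show ?thesis unfolding f_max_def by (simp add: Suc_le_eq card_gt_0_iff)
qed

text \<open>The sets \<open>T A\<close> are free: two summands from above \<open>n / 4\<close>
  exceed \<open>n\<close>, and with a summand 1 the pair \<open>y\<close>, \<open>2 * y + 2\<close>
  would have to be chosen completely.\<close>

lemma f_max_lower:
  assumes n: "n \<ge> 16"
  shows "2 powr (real n / 4 - 2) \<le> real (f_max n)"
proof -
  define k where "k = n div 4"
  define h where "h = n div 2"
  define Y where "Y = {k+1..h-1}"
  define T where "T A = insert 1 (A \<union> (\<lambda>y. 2 * y + 2) ` (Y - A))" for A
  \<comment> \<open>This puts \<open>4 = 2 * 1 + 2 * 1\<close> below \<open>k + 1\<close>, hence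
    outside \<open>T A\<close>.\<close>
  have k4: "k \<ge> 4" using n by (simp add: k_def)
  have hk: "2 * k \<le> h" "h \<le> 2 * k + 1" "2 * h \<le> n" "n < 4 * k + 4" by (auto simp: k_def h_def)
  have TA: "T A \<subseteq> {1..n}" "L_free (T A)" if A: "A \<subseteq> Y" for A
  proof -
    have Tel: "x = 1 \<or> x \<in> A \<or> (\<exists>y\<in>Y - A. x = 2 * y + 2)" if "x \<in> T A" for x
      using that by (auto simp: T_def)
    have big: "x = 1 \<or> k + 1 \<le> x" if "x \<in> T A" for x
      using Tel[OF that] A by (auto simp: Y_def)
    show "T A \<subseteq> {1..n}"
    proof
      fix x assume "x \<in> T A"
      then show "x \<in> {1..n}" using Tel[of x] A hk k4 by (fastforce simp: Y_def)
    qed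
    have one: "2 + 2 * b \<notin> T A" if b: "b \<in> T A" for b
    proof
      assume c: "2 + 2 * b \<in> T A"
      show False
        using Tel[OF b]
      proof (elim disjE bexE)
        assume "b = 1" then show False using c big[OF c] Tel[OF c] k4 by auto
      next
        assume "b \<in> A"
        moreover have "k + 1 \<le> b" using A calculation by (auto simp: Y_def)
        moreover have "2 + 2 * b \<notin> Y" using calculation hk by (auto simp: Y_def)
        ultimately show False using Tel[OF c] A by auto
      next
        fix y assume y: "y \<in> Y - A" "b = 2 * y + 2"
        then have "2 + 2 * b > n" using hk by (auto simp: Y_def)
        then show False using c \<open>T A \<subseteq> {1..n}\<close> by auto
      qed
    qed
    show "L_free (T A)"
      unfolding L_free_def
    proof (intro notI, elim bexE)
      fix a b c assume abc: "a \<in> T A" "b \<in> T A" "c \<in> T A" "2 * a + 2 * b = c"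
      show False
      proof (cases "a = 1 \<or> b = 1")
        case True
        then show False using one abc by (auto simp: add.commute)
      next
        case False
        then have "c > n" using big[OF abc(1)] big[OF abc(2)] abc(4) hk by auto
        then show False using abc(3) \<open>T A \<subseteq> {1..n}\<close> by auto
      qed
    qed
  qed
  have "\<forall>A\<in>Pow Y. \<exists>M. T A \<subseteq> M \<and> maximal_L_free n M" using L_free_extend TA by blast
  then obtain g where g: "\<And>A. A \<subseteq> Y \<Longrightarrow> T A \<subseteq> g A \<and> maximal_L_free n (g A)"
    by (metis PowI)
  have sub: "A \<subseteq> A'" if A: "A \<subseteq> Y" "A' \<subseteq> Y" "g A = g A'" for A A'
  proof
    fix y assume y: "y \<in> A"
    show "y \<in> A'"
    proof (rule ccontr)
      assume "y \<notin> A'"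
      then have "2 * 1 + 2 * y \<in> T A'" "y \<in> T A" "1 \<in> T A" using y A by (auto simp: T_def)
      then have "2 * 1 + 2 * y \<in> g A" "y \<in> g A" "1 \<in> g A" using g[OF A(1)] g[OF A(2)] A(3) by auto
      then show False using g[OF A(1)] unfolding maximal_L_free_def L_free_def by blast
    qed
  qed
  have "inj_on g (Pow Y)" by (rule inj_onI) (use sub in \<open>simp add: subset_antisym\<close>)
  then have "card (Pow Y) \<le> f_max n" unfolding f_max_def
    by (rule card_inj_on_le) (use g finite_maximal[of n "\<lambda>_. True"] in auto)
  then have c: "2 ^ card Y \<le> f_max n" by (simp add: card_Pow Y_def)
  have "real n / 4 - 2 \<le> real (card Y)"
  proof -
    have "n \<le> 4 * card Y + 8" by (auto simp: Y_def k_def h_def)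
    then show ?thesis by linarith
  qed
  then have "2 powr (real n / 4 - 2) \<le> 2 powr (real (card Y))" by (intro powr_mono) auto
  also have "\<dots> = real (2 ^ card Y)" by (simp add: powr_realpow)
  also have "\<dots> \<le> real (f_max n)" using c by (rule of_nat_mono)
  finally show ?thesis .
qed

section \<open>Structure of L-free sets\<close>

lemma card_residue_class_le:
  fixes a b d r :: nat
  assumes "d > 0"
  shows "d * card {z\<in>{a..b}. z mod d = r} \<le> b + d - a"
proof (cases "a \<le> b")
  case True
  have "inj_on (\<lambda>z. (z - a) div d) {z\<in>{a..b}. z mod d = r}"
  proof (rule linorder_inj_onI)
    fix x y assume xy: "x < y" "x \<in> {z\<in>{a..b}. z mod d = r}" "y \<in> {z\<in>{a..b}. z mod d = r}"
    then have "d dvd y - x" by (metis (mono_tags, lifting) less_imp_le_nat mem_Collect_eq mod_eq_dvd_iff_nat)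
    then have "x + d \<le> y" using xy(1) by (auto dest!: dvd_imp_le)
    then have "(x - a) + d \<le> y - a" using xy(2) by auto
    then have "((x - a) + d) div d \<le> (y - a) div d" by (rule div_le_mono)
    then show "(x - a) div d \<noteq> (y - a) div d" using assms by simp
  qed auto
  then have "card {z\<in>{a..b}. z mod d = r} \<le> card {..(b - a) div d}"
    by (rule card_inj_on_le) (auto intro: div_le_mono)
  then have "d * card {z\<in>{a..b}. z mod d = r} \<le> d * card {..(b - a) div d}"
    by (rule mult_le_mono2)
  also have "\<dots> = d * ((b - a) div d + 1)" by simp
  also have "\<dots> \<le> (b - a) + d" by simp
  finally show ?thesis using True by simp
qed simp

lemma card_even_le: "2 * card {z\<in>{a..b}. even z} \<le> b + 2 - a" for a b :: nat
  using card_residue_class_le[of 2 a b 0] by (simp add: even_iff_mod_2_eq_zero)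

lemma card_odd_le: "2 * card {z\<in>{a..b}. odd z} \<le> b + 2 - a" for a b :: nat
  using card_residue_class_le[of 2 a b 1] by (simp add: odd_iff_mod_2_eq_one)

text \<open>If \<open>4 dvd z \<in> B\<close>, then \<open>B\<close> meets each pair \<open>{x, z/2 - x}\<close> of odd numbers at most once.\<close>

lemma multiple_of_4_bound:
  assumes B: "B \<subseteq> {1..n}" "L_free B" and z: "z \<in> B" "4 dvd z"
  shows "z \<le> 8 * card ({x\<in>{1..n div 2}. odd x} - B)"
proof -
  obtain k where k: "z = 4 * k" using z(2) by auto
  define w where "w = 2 * k"
  have wz: "z = 2 * w" using k by (auto simp: w_def)
  have "z \<le> n" using z(1) B(1) by auto
  then have wh: "w \<le> n div 2" using wz by simp
  define W where "W = {x. x < w \<and> odd x}"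
  have finW: "finite W" by (simp add: W_def)
  have "W = (\<lambda>j. 2 * j + 1) ` {..<k}"
    by (auto simp: W_def w_def elim!: oddE)
  then have cW: "card W = k" by (simp add: card_image inj_on_def)
  \<comment> \<open>Since \<open>w\<close> is even, \<open>w - x\<close> is odd again. At least half
    of the \<open>k = z / 4\<close> elements of \<open>W\<close> are therefore missing from
    \<open>B\<close>, which gives the factor 8.\<close>
  have "card (W \<inter> B) \<le> card (W - B)"
  proof (rule card_inj_on_le[where f = "\<lambda>x. w - x"])
    show "inj_on (\<lambda>x. w - x) (W \<inter> B)" by (auto simp: inj_on_def W_def)
    show "(\<lambda>x. w - x) ` (W \<inter> B) \<subseteq> W - B"
    proof
      fix y assume "y \<in> (\<lambda>x. w - x) ` (W \<inter> B)"
      then obtain x where x: "x \<in> W" "x \<in> B" "y = w - x" by auto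
      have "2 * x + 2 * y = z" using x wz by (auto simp: W_def)
      then have "y \<notin> B" using B(2) x(2) z(1) unfolding L_free_def by blast
      moreover have "y \<in> W" using x by (auto simp: W_def w_def odd_pos)
      ultimately show "y \<in> W - B" by simp
    qed
  qed (use finW in simp)
  moreover have "card W = card (W \<inter> B) + card (W - B)"
    using finW by (metis card_Int_Diff)
  moreover have "card (W - B) \<le> card ({x\<in>{1..n div 2}. odd x} - B)"
    by (rule card_mono) (use wh in \<open>auto simp: W_def odd_pos Suc_le_eq\<close>)
  ultimately show ?thesis using cW k by linarith
qed

text \<open>Since \<open>m \<in> B\<close>, the values \<open>2 * x + 2 * m\<close> for
  \<open>x \<in> P\<close> avoid \<open>B\<close>, so \<open>P\<close> and \<open>Q\<close> compete
  for the even numbers from \<open>4 * m\<close> to \<open>2 * h\<close>; this is \<open>PQ\<close>.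
  The first alternative arises for \<open>h < 2 * m\<close>, the second for
  \<open>2 * m \<le> h\<close> and \<open>n \<le> 8 * m\<close>, and smaller \<open>m\<close> leads
  to the first or the third.\<close>

lemma L_free_structure:
  fixes n :: nat
  assumes B: "B \<subseteq> {1..n}" "L_free B" "B \<noteq> {}"
  defines "m \<equiv> Min B" and "h \<equiv> n div 2"
  shows "4 * card (B \<inter> {1..h}) \<le> n + 8 \<or>
     2 * m \<le> h \<and> 4 * card (B \<inter> {m..h - m} \<union> {z\<in>B. even z \<and> h < z}) \<le> n + 8 \<or>
     32 * card (B - large_odds n) \<le> 15 * n + 128"
proof -
  have finB: "finite B" using B finite_subset by blast
  have mB: "m \<in> B" and mle: "\<And>x. x \<in> B \<Longrightarrow> m \<le> x" using finB B(3) by (auto simp: m_def)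
  have m1: "1 \<le> m" using mB B by auto
  have h: "2 * h \<le> n" "n \<le> 2 * h + 1" by (auto simp: h_def)
  define P where "P = B \<inter> {m..h - m}"
  define Q where "Q = {z\<in>B. even z \<and> 4 * m \<le> z}"
  define Z where "Z = {z\<in>B. even z \<and> h < z}"
  have fin: "finite P" "finite Q" "finite Z" using finB by (auto simp: P_def Q_def Z_def)
  show ?thesis
  proof (cases "2 * m \<le> h")
    case False
    have "card (B \<inter> {1..h}) \<le> card {m..h}"
      by (rule card_mono) (use mle in auto)
    then have "card (B \<inter> {1..h}) \<le> Suc h - m" by simp
    then show ?thesis using False h by linarith
  next
    case True
    define X where "X = (\<lambda>x. 2 * x + 2 * m) ` P"
    have "card X = card P" by (simp add: X_def card_image inj_on_def)
    moreover have "X \<inter> Q = {}"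
      using B(2) mB unfolding X_def P_def Q_def L_free_def by blast
    moreover have "card (X \<union> Q) \<le> card {z\<in>{4 * m..2 * h}. even z}"
    proof (rule card_mono)
      have "Q \<subseteq> {z\<in>{4 * m..2 * h}. even z}"
        using B(1) h by (auto simp: Q_def elim!: evenE)
      moreover have "X \<subseteq> {z\<in>{4 * m..2 * h}. even z}"
        using True by (auto simp: X_def P_def)
      ultimately show "X \<union> Q \<subseteq> {z\<in>{4 * m..2 * h}. even z}" by blast
    qed simp
    ultimately have PQ: "2 * card P + 2 * card Q + 4 * m \<le> 2 * h + 2"
      using card_even_le[of "4 * m" "2 * h"] fin True by (simp add: card_Un_disjoint X_def)
    show ?thesis
    proof (cases "n \<le> 8 * m")
      case True': True
      \<comment> \<open>\<open>Q\<close> misses the even elements of \<open>B\<close> between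
        \<open>h\<close> and \<open>4 * m\<close>; the term \<open>4 * m\<close> in
        \<open>PQ\<close> pays for them.\<close>
      have "card Z \<le> card (Q \<union> {z\<in>{h + 1..4 * m - 1}. even z})"
        by (rule card_mono) (use fin in \<open>auto simp: Z_def Q_def\<close>)
      also have "\<dots> \<le> card Q + card {z\<in>{h + 1..4 * m - 1}. even z}" by (rule card_Un_le)
      finally have "2 * card Z \<le> 2 * card Q + (4 * m - h)"
        using card_even_le[of "h + 1" "4 * m - 1"] m1 by linarith
      moreover have "h \<le> 4 * m" using True' h by linarith
      ultimately have "2 * card Z + h \<le> 2 * card Q + 4 * m" by linarith
      then have "4 * card P + 4 * card Z \<le> n + 8" using PQ h by linarith
      moreover have "card (P \<union> Z) \<le> card P + card Z" by (rule card_Un_le)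
      ultimately have "4 * card (P \<union> Z) \<le> n + 8" by simp
      then show ?thesis using True by (simp add: P_def Z_def)
    next
      case False
      \<comment> \<open>\<open>s\<close> counts the even elements of \<open>B\<close> from
        \<open>4 * m\<close> to \<open>h - m\<close>. They occur in both \<open>P\<close> and
        \<open>Q\<close>, so a large \<open>s\<close> improves the bound on the union.\<close>
      define s where "s = card (P \<inter> Q)"
      have PQs: "card (P \<union> Q) + s = card P + card Q"
        unfolding s_def using card_Un_Int[OF fin(1,2)] by simp
      have small: "x \<le> h" if "x \<in> B - large_odds n" "odd x" for x
        using that B(1) by (auto simp: large_odds_def h_def)
      have sub: "B - large_odds n \<subseteq> (P \<union> Q) \<union> {z\<in>{h - m + 1..h}. odd z} \<union> {z\<in>{h - m + 1..4 * m - 1}. even z}"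
      proof
        fix x assume x: "x \<in> B - large_odds n"
        then have "m \<le> x" "x \<in> B" using mle by auto
        then show "x \<in> (P \<union> Q) \<union> {z\<in>{h - m + 1..h}. odd z} \<union> {z\<in>{h - m + 1..4 * m - 1}. even z}"
          using small[OF x] by (cases "odd x") (auto simp: P_def Q_def)
      qed
      have "card (B - large_odds n) \<le> card ((P \<union> Q) \<union> {z\<in>{h - m + 1..h}. odd z} \<union> {z\<in>{h - m + 1..4 * m - 1}. even z})"
        using fin sub by (intro card_mono) auto
      also have "\<dots> \<le> card (P \<union> Q) + card {z\<in>{h - m + 1..h}. odd z} + card {z\<in>{h - m + 1..4 * m - 1}. even z}"
        by (meson add_le_mono1 card_Un_le le_trans)
      finally have "card (B - large_odds n) \<le> card (P \<union> Q) + card {z\<in>{h - m + 1..h}. odd z} + card {z\<in>{h - m + 1..4 * m - 1}. even z}" .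
      moreover have "2 * card {z\<in>{h - m + 1..h}. odd z} \<le> m + 1"
        using card_odd_le[of "h - m + 1" h] True by linarith
      moreover have "2 * card {z\<in>{h - m + 1..4 * m - 1}. even z} \<le> 5 * m - h"
        using card_even_le[of "h - m + 1" "4 * m - 1"] True m1 by linarith
      ultimately have tot: "2 * card (B - large_odds n) + 2 * s + 3 * m \<le> 2 * h + 3 + (5 * m - h)"
        using PQ PQs by linarith
      \<comment> \<open>By \<open>tot\<close> the last alternative holds unless \<open>m\<close> and \<open>s\<close> are small. In that case \<open>B\<close> has few
        even elements up to \<open>h\<close>, so if the first alternative fails it contains nearly all odd numbers there,
        hence no multiple of 4 above \<open>n/3\<close>; this makes it small enough again.\<close>
      show ?thesis
      proof (cases "5 * m > h \<or> 48 * m + 32 * s \<ge> n")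
        case True
        \<comment> \<open>If \<open>5 * m \<le> h\<close>, multiplying \<open>tot\<close> by 16
          leaves \<open>16 * n + 48 - 48 * m - 32 * s\<close>. If \<open>5 * m > h\<close>, then
          \<open>m < n / 8\<close> gives about \<open>12 * n\<close>.\<close>
        then have "32 * card (B - large_odds n) \<le> 15 * n + 128"
          using tot h False by linarith
        then show ?thesis by blast
      next
        case False': False
        show ?thesis
        proof (cases "4 * card (B \<inter> {1..h}) \<le> n + 8")
          case big: False
          define Ev where "Ev = {x\<in>B \<inter> {1..h}. even x}"
          define Od where "Od = {x\<in>B \<inter> {1..h}. odd x}"
          define Odds where "Odds = {x\<in>{1..h}. odd x}"
          have cOdds: "2 * card Odds \<le> h + 1" using card_odd_le[of 1 h] by (simp add: Odds_def)
          have "Ev \<subseteq> (P \<inter> Q) \<union> {z\<in>{m..4 * m - 1}. even z} \<union> {z\<in>{h - m + 1..h}. even z}"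
          proof
            fix x assume x: "x \<in> Ev"
            then have "m \<le> x" using mle by (auto simp: Ev_def)
            then show "x \<in> (P \<inter> Q) \<union> {z\<in>{m..4 * m - 1}. even z} \<union> {z\<in>{h - m + 1..h}. even z}"
              using x by (auto simp: Ev_def P_def Q_def)
          qed
          then have "card Ev \<le> card ((P \<inter> Q) \<union> {z\<in>{m..4 * m - 1}. even z} \<union> {z\<in>{h - m + 1..h}. even z})"
            using fin by (intro card_mono) auto
          also have "\<dots> \<le> s + card {z\<in>{m..4 * m - 1}. even z} + card {z\<in>{h - m + 1..h}. even z}"
            unfolding s_def by (meson add_le_mono1 card_Un_le le_trans)
          finally have Ev: "2 * card Ev \<le> 2 * s + 4 * m + 2"
            using card_even_le[of m "4 * m - 1"] card_even_le[of "h - m + 1" h] m1 True by linarith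
          have "B \<inter> {1..h} = Od \<union> Ev" "Od \<inter> Ev = {}" by (auto simp: Od_def Ev_def)
          moreover have finOE: "finite Od" "finite Ev" using finB by (auto simp: Od_def Ev_def)
          ultimately have BO: "card (B \<inter> {1..h}) = card Od + card Ev"
            by (simp add: card_Un_disjoint)
          have "Odds \<inter> B = Od" by (auto simp: Odds_def Od_def)
          then have "card Odds = card Od + card (Odds - B)"
            using card_Int_Diff[of Odds B] by (simp add: Odds_def)
          \<comment> \<open>More than \<open>n / 4 + 2\<close> elements lie up to \<open>h\<close>,
            at most \<open>s + 2 * m + 1\<close> of them even, against at most
            \<open>(h + 1) / 2\<close> odd numbers; so fewer than \<open>s + 2 * m < n / 24\<close>
            odd numbers are missing.\<close>
          then have miss: "24 * card (Odds - B) < n"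
            using cOdds BO big Ev False' h by linarith
          have "Z \<subseteq> {z\<in>{h + 1..n}. z mod 4 = 2}"
          proof
            fix z assume z: "z \<in> Z"
            have "\<not> 4 dvd z"
            proof
              assume "4 dvd z"
              then have "z \<le> 8 * card (Odds - B)"
                using multiple_of_4_bound[OF B(1,2), of z] z by (simp add: Z_def Odds_def h_def)
              then show False using miss z h by (simp add: Z_def)
            qed
            moreover have "even z" using z by (simp add: Z_def)
            ultimately have "z mod 4 = 2" by presburger
            then show "z \<in> {z\<in>{h + 1..n}. z mod 4 = 2}" using z B(1) by (auto simp: Z_def)
          qed
          then have "card Z \<le> card {z\<in>{h + 1..n}. z mod 4 = 2}" by (intro card_mono) auto
          then have cZ: "4 * card Z \<le> n + 3 - h" using card_residue_class_le[of 4 "h + 1" n 2] by simp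
          have "B - large_odds n \<subseteq> Odds \<union> Ev \<union> Z"
          proof
            fix x assume x: "x \<in> B - large_odds n"
            then have "1 \<le> x" "x \<in> B" using B(1) by auto
            then show "x \<in> Odds \<union> Ev \<union> Z"
              using small[OF x] by (cases "odd x") (auto simp: Odds_def Ev_def Z_def)
          qed
          then have "card (B - large_odds n) \<le> card (Odds \<union> Ev \<union> Z)"
            using finOE fin by (intro card_mono) (auto simp: Odds_def)
          also have "\<dots> \<le> card Odds + card Ev + card Z"
            by (meson add_le_mono1 card_Un_le le_trans)
          \<comment> \<open>The three parts have size about \<open>n / 4\<close>,
            \<open>n / 24\<close> and \<open>n / 8\<close> at most, which is well below
            \<open>15 * n / 32\<close>.\<close>
          finally have "32 * card (B - large_odds n) \<le> 15 * n + 128"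
            using cOdds Ev cZ False' h by linarith
          then show ?thesis by blast
        qed blast
      qed
    qed
  qed
qed

section \<open>The two bounds combined\<close>

text \<open>Because \<open>3 ^ 5 = 243 \<le> 256 = 2 ^ 8\<close>. The exponent fits the third
  structural alternative exactly: \<open>8 / 5 * (15 / 96) = 1 / 4\<close>.\<close>

lemma three_powr_le:
  assumes "0 \<le> t" shows "(3::real) powr t \<le> 2 powr (8 / 5 * t)"
proof -
  have "(3::real) ^ 5 \<le> (2 powr (8/5)) ^ 5"
  proof -
    have "(2 powr (8/5)) ^ 5 = (2::real) powr 8" by (simp add: powr_powr flip: powr_realpow)
    then show ?thesis by (simp add: powr_numeral)
  qed
  then have "(3::real) \<le> 2 powr (8/5)"
    by (metis power_mono_iff powr_ge_zero zero_le_numeral zero_less_numeral)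
  then have "3 powr t \<le> (2 powr (8/5)) powr t" using assms by (intro powr_mono2) auto
  then show ?thesis by (simp add: powr_powr)
qed

lemma card_maximal_in_container:
  assumes B: "B \<subseteq> {1..n}" "L_free B" and C: "C \<subseteq> {1..n}"
  shows "real (card {S. maximal_L_free n S \<and> S \<subseteq> B \<union> C}) \<le> 2 powr (real (card C) + real n / 4 + 3)"
proof -
  define h where "h = n div 2"
  have h: "2 * h \<le> n" "n \<le> 2 * h + 1" by (auto simp: h_def)
  have finC: "finite C" and finB: "finite B" using B C finite_subset by auto
  have U: "B \<union> C \<subseteq> {1..n}" using B C by auto
  have determined: ?thesis
    if K': "K' \<subseteq> B" "4 * card K' \<le> n + 8"
      and det: "\<And>x y z. x \<in> B - C - K' \<Longrightarrow> y \<in> B \<union> C \<Longrightarrow> z \<in> B \<union> C \<Longrightarrow> triad x y z \<Longrightarrow> y \<in> C \<union> K'"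
    for K'
  proof -
    have finK: "finite (C \<union> K')" using finC finB K' finite_subset by blast
    have "card {S. maximal_L_free n S \<and> S \<subseteq> B \<union> C} \<le> 2 ^ card (C \<union> K')"
    proof (rule card_maximal_determined[OF finK U])
      fix x y z assume "x \<in> B \<union> C - (C \<union> K')" "y \<in> B \<union> C" "z \<in> B \<union> C" "triad x y z"
      then show "y \<in> C \<union> K' \<and> z \<in> C \<union> K'"
        using det[of x y z] det[of x z y] triad_swap(2)[of x y z] by blast
    qed
    also have "\<dots> \<le> 2 ^ (card C + card K')" by (intro power_increasing card_Un_le) simp
    finally have "real (card {S. maximal_L_free n S \<and> S \<subseteq> B \<union> C}) \<le> real (2 ^ (card C + card K'))"
      by (rule of_nat_mono)
    also have "\<dots> = 2 powr (real (card C) + real (card K'))" by (simp add: powr_realpow flip: of_nat_add)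
    also have "\<dots> \<le> 2 powr (real (card C) + real n / 4 + 3)"
      using K'(2) by (intro powr_mono) auto
    finally show ?thesis .
  qed
  consider (lower) "4 * card (B \<inter> {1..h}) \<le> n + 8"
    | (middle) "B \<noteq> {}" "2 * Min B \<le> h" "4 * card (B \<inter> {Min B..h - Min B} \<union> {z\<in>B. even z \<and> h < z}) \<le> n + 8"
    | (graph) "32 * card (B - large_odds n) \<le> 15 * n + 128"
    using L_free_structure[OF B] unfolding h_def by (cases "B = {}") auto
  then show ?thesis
  proof cases
    case lower
    show ?thesis
    proof (rule determined[OF _ lower])
      fix x y z assume "x \<in> B - C - B \<inter> {1..h}" "y \<in> B \<union> C" "z \<in> B \<union> C" "triad x y z"
      moreover then have "x > h" "x \<le> n" "y \<le> n" "z \<le> n" "1 \<le> y" using B C by auto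
      \<comment> \<open>As \<open>2 * x > n\<close>, the element \<open>x\<close> can only be the
        value of the equation, so \<open>y\<close> is a summand and at most
        \<open>n / 4\<close>.\<close>
      ultimately show "y \<in> C \<union> B \<inter> {1..h}"
        using h by (auto simp: triad_def)
    qed auto
  next
    case middle
    define m where "m = Min B"
    define K where "K = B \<inter> {m..h - m} \<union> {z\<in>B. even z \<and> h < z}"
    have mle: "m \<le> x" if "x \<in> B" for x using that finB by (simp add: m_def)
    have m: "2 * m \<le> h" using middle by (simp add: m_def)
    show ?thesis
    proof (rule determined[of K])
      fix x y z assume xyz: "x \<in> B - C - K" "y \<in> B \<union> C" "z \<in> B \<union> C" "triad x y z"
      have n: "x \<in> {1..n}" "y \<in> {1..n}" "z \<in> {1..n}" using xyz U by auto
      \<comment> \<open>Outside \<open>K\<close> there remain elements in no triad and those in the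
        window from \<open>h - m + 1\<close> to \<open>h\<close>. As \<open>2 * m \<le> h\<close>,
        doubling a number of the window exceeds \<open>h\<close>, so no triad within range contains
        two of them.\<close>
      have rng: "h - m < u \<and> u \<le> h \<or> u \<in> large_odds n" if "u \<in> B - K" for u
        using that mle[of u] B(1) h by (fastforce simp: K_def large_odds_def)
      have x: "h - m < x" "x \<le> h"
        using rng[of x] large_odds_no_triad[of x n y z] n xyz(1,4) by auto
      show "y \<in> C \<union> K"
      proof (rule ccontr)
        assume "y \<notin> C \<union> K"
        moreover have "triad y x z" using xyz(4) triad_swap(1) by blast
        ultimately have "h - m < y" "y \<le> h"
          using rng[of y] large_odds_no_triad[of y n x z] n xyz(2) by auto
        then show False using x m h n xyz(4) by (auto simp: triad_def)
      qed
    qed (use middle in \<open>auto simp: K_def m_def\<close>)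
  next
    case graph
    define t where "t = real (card (B - large_odds n)) / 3"
    have "3 powr t \<le> 2 powr (8 / 5 * t)" by (rule three_powr_le) (simp add: t_def)
    also have "\<dots> \<le> 2 powr (real n / 4 + 3)"
      using graph by (intro powr_mono) (auto simp: t_def)
    finally have "2 ^ card C * 3 powr t \<le> 2 powr real (card C) * 2 powr (real n / 4 + 3)"
      by (simp add: powr_realpow)
    also have "\<dots> = 2 powr (real (card C) + real n / 4 + 3)" by (simp add: powr_add)
    finally show ?thesis
      using card_maximal_link_graph[OF B finC] unfolding t_def by linarith
  qed
qed

lemma f_max_upper:
  assumes \<eta>: "0 < \<eta>"
  shows "\<exists>n0. \<forall>n\<ge>n0. real (f_max n) \<le> 2 powr (real n / 4 + \<eta> * real n)"
proof -
  \<comment> \<open>Four losses of \<open>\<epsilon> * n\<close> in the exponent: the number of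
    containers, the set \<open>T\<close>, the removed set \<open>C0\<close>, and the constant
    3.\<close>
  define \<epsilon> where "\<epsilon> = \<eta> / 4"
  have \<epsilon>: "\<epsilon> > 0" using \<eta> by (simp add: \<epsilon>_def)
  obtain \<delta> where \<delta>: "\<delta> > 0" and rem: "\<And>n F. F \<subseteq> {1..n} \<Longrightarrow> real (card (triads F)) \<le> \<delta> * (real n)\<^sup>2 \<Longrightarrow>
     (\<exists>C\<subseteq>F. real (card C) \<le> \<epsilon> * real n \<and> L_free (F - C))"
    using arithmetic_removal[OF \<epsilon>] by blast
  obtain n1 where n1: "\<And>n. n \<ge> n1 \<Longrightarrow> \<exists>\<F>. finite \<F> \<and> real (card \<F>) \<le> 2 powr (\<epsilon> * real n) \<and>
     (\<forall>(B,T)\<in>\<F>. B \<subseteq> {1..n} \<and> finite T \<and> real (card T) \<le> \<epsilon> * real n \<and>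
         real (card (triads B)) \<le> \<delta> * (real n)\<^sup>2) \<and>
     (\<forall>S. S \<subseteq> {1..n} \<longrightarrow> L_free S \<longrightarrow> (\<exists>(B,T)\<in>\<F>. S \<subseteq> B \<union> T))"
    using containers[OF \<epsilon> \<delta>] by blast
  obtain n2 :: nat where n2: "real n2 > 3 / \<epsilon>" using reals_Archimedean2 by blast
  show ?thesis
  proof (intro exI[of _ "max n1 n2"] allI impI)
    fix n assume n: "max n1 n2 \<le> n"
    have "3 / \<epsilon> < real n" using n n2 by simp
    then have n3: "3 \<le> \<epsilon> * real n" using \<epsilon> by (simp add: field_simps)
    obtain \<F> where F: "finite \<F>" "real (card \<F>) \<le> 2 powr (\<epsilon> * real n)"
     and F': "\<forall>(B,T)\<in>\<F>. B \<subseteq> {1..n} \<and> finite T \<and> real (card T) \<le> \<epsilon> * real n \<and>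
         real (card (triads B)) \<le> \<delta> * (real n)\<^sup>2"
     and cover: "\<forall>S. S \<subseteq> {1..n} \<longrightarrow> L_free S \<longrightarrow> (\<exists>(B,T)\<in>\<F>. S \<subseteq> B \<union> T)"
      using n1[of n, OF order_trans[OF max.cobounded1 n]] by blast
    define Fam where "Fam w = {S. maximal_L_free n S \<and> S \<subseteq> fst w \<union> snd w}" for w
    have each: "real (card (Fam w)) \<le> 2 powr (real n / 4 + 3 * \<epsilon> * real n)" if w: "w \<in> \<F>" for w
    proof -
      obtain B T where BT: "w = (B,T)" by (cases w)
      have FB: "B \<subseteq> {1..n}" "finite T" "real (card T) \<le> \<epsilon> * real n"
        "real (card (triads B)) \<le> \<delta> * (real n)\<^sup>2"
        using F' w unfolding BT by blast+
      obtain C0 where C0: "C0 \<subseteq> B" "real (card C0) \<le> \<epsilon> * real n" "L_free (B - C0)"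
        using rem[of B n] FB by blast
      define C where "C = C0 \<union> (T \<inter> {1..n})"
      have "card C \<le> card C0 + card (T \<inter> {1..n})" unfolding C_def by (rule card_Un_le)
      also have "\<dots> \<le> card C0 + card T" using FB by (simp add: card_mono)
      finally have cC: "real (card C) \<le> 2 * \<epsilon> * real n" using C0(2) FB by linarith
      have "Fam w \<subseteq> {S. maximal_L_free n S \<and> S \<subseteq> (B - C0) \<union> C}"
        by (auto simp: Fam_def BT C_def maximal_L_free_def)
      then have "real (card (Fam w)) \<le> real (card {S. maximal_L_free n S \<and> S \<subseteq> (B - C0) \<union> C})"
        by (intro of_nat_mono card_mono finite_maximal)
      also have "\<dots> \<le> 2 powr (real (card C) + real n / 4 + 3)"
        by (rule card_maximal_in_container) (use FB C0 in \<open>auto simp: C_def\<close>)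
      also have "\<dots> \<le> 2 powr (real n / 4 + 3 * \<epsilon> * real n)"
        using cC n3 by (intro powr_mono) auto
      finally show ?thesis .
    qed
    have "{S. maximal_L_free n S} \<subseteq> (\<Union>w\<in>\<F>. Fam w)"
    proof
      fix S assume "S \<in> {S. maximal_L_free n S}"
      then have S: "maximal_L_free n S" "S \<subseteq> {1..n}" "L_free S" by (auto simp: maximal_L_free_def)
      then have "\<exists>w\<in>\<F>. S \<subseteq> fst w \<union> snd w"
        using cover by (simp add: case_prod_unfold)
      then show "S \<in> (\<Union>w\<in>\<F>. Fam w)" using S(1) by (auto simp: Fam_def)
    qed
    moreover have "finite (Fam w)" for w unfolding Fam_def by (rule finite_maximal)
    ultimately have "f_max n \<le> card (\<Union>w\<in>\<F>. Fam w)"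
      unfolding f_max_def using F(1) by (intro card_mono) auto
    also have "\<dots> \<le> (\<Sum>w\<in>\<F>. card (Fam w))" by (rule card_UN_le[OF F(1)])
    finally have "real (f_max n) \<le> real (\<Sum>w\<in>\<F>. card (Fam w))" by (rule of_nat_mono)
    also have "\<dots> = (\<Sum>w\<in>\<F>. real (card (Fam w)))" by simp
    also have "\<dots> \<le> (\<Sum>w\<in>\<F>. 2 powr (real n / 4 + 3 * \<epsilon> * real n))" by (rule sum_mono[OF each])
    also have "\<dots> = real (card \<F>) * 2 powr (real n / 4 + 3 * \<epsilon> * real n)" by simp
    also have "\<dots> \<le> 2 powr (\<epsilon> * real n) * 2 powr (real n / 4 + 3 * \<epsilon> * real n)"
      using F(2) by (intro mult_right_mono) auto
    also have "\<dots> = 2 powr (\<epsilon> * real n + (real n / 4 + 3 * \<epsilon> * real n))"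
      by (rule powr_add[symmetric])
    also have "\<dots> = 2 powr (real n / 4 + \<eta> * real n)"
      by (simp add: \<epsilon>_def algebra_simps)
    finally show "real (f_max n) \<le> 2 powr (real n / 4 + \<eta> * real n)" .
  qed
qed

theorem theorem25:
  shows "\<exists>\<epsilon> :: nat \<Rightarrow> real. \<epsilon> \<in> o(\<lambda>n. real n) \<and>
           (\<forall>n. real (f_max n) = 2 powr (real n / 4 + \<epsilon> n))"
proof -
  define \<epsilon> where "\<epsilon> n = log 2 (real (f_max n)) - real n / 4" for n
  have pos: "real (f_max n) > 0" for n using f_max_pos[of n] by simp
  have "\<epsilon> \<in> o(\<lambda>n. real n)"
  proof (rule landau_o.smallI)
    fix c :: real assume c: "c > 0"
    obtain n0 where n0: "\<And>n. n \<ge> n0 \<Longrightarrow> real (f_max n) \<le> 2 powr (real n / 4 + c * real n)"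
      using f_max_upper[OF c] by blast
    obtain n1 :: nat where n1: "real n1 > 2 / c" using reals_Archimedean2 by blast
    have "norm (\<epsilon> n) \<le> c * norm (real n)" if n: "n \<ge> max 16 (max n0 n1)" for n
    proof -
      have "log 2 (real (f_max n)) \<le> real n / 4 + c * real n"
        using n0[of n] n pos[of n] by (simp add: log_le_iff)
      moreover have "real n / 4 - 2 \<le> log 2 (real (f_max n))"
        using f_max_lower[of n] n pos[of n] by (simp add: le_log_iff)
      moreover have "2 / c < real n" using n n1 by simp
      then have "2 \<le> c * real n" using c by (simp add: field_simps)
      ultimately show ?thesis unfolding \<epsilon>_def by simp
    qed
    then show "\<forall>\<^sub>F n in sequentially. norm (\<epsilon> n) \<le> c * norm (real n)"
      unfolding eventually_sequentially by blast
  qed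
  moreover have "real (f_max n) = 2 powr (real n / 4 + \<epsilon> n)" for n
    using pos[of n] by (simp add: \<epsilon>_def)
  ultimately show ?thesis by blast
qed

end
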